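(* Let $(\mathfrak{g},B)$ be an indecomposable quadratic Lie superalgebra of dimension 5. (a) If $\mathfrak{g}_{\overline 0}$ is solvable, then $\mathfrak{g}$ is i-isomorphic to the nilpotent quadratic Lie algebra $\mathfrak{g}_5$ (with zero odd part) with basis $\{X_1,X_2,T,Z_1,Z_2\}$, nonzero brackets $[X_1,X_2]=T$, $[X_1,T]=-Z_2$, $[X_2,T]=Z_1$, and bilinear form $B(X_1,Z_1)=B(X_2,Z_2)=B(T,T)=1$, zero otherwise. (b) If $\mathfrak{g}_{\overline 1}\neq\{0\}$ and $\mathfrak{g}_{\overline 0}$ is not solvable, then $\dim\mathfrak{g}_{\overline 0}=3$, $\dim\mathfrak{g}_{\overline 1}=2$ and $\mathfrak{g}$ is isomorphic to $\mathfrak{osp}(1,2)$.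
   Context: All vector spaces are finite-dimensional over $\mathbb{C}$. A quadratic Lie superalgebra is a Lie superalgebra $\mathfrak{g}=\mathfrak{g}_{\overline 0}\oplus\mathfrak{g}_{\overline 1}$ with a non-degenerate bilinear form $B$ that is supersymmetric ($B(Y,X)=(-1)^{xy}B(X,Y)$ for $X\in\mathfrak{g}_x$, $Y\in\mathfrak{g}_y$), invariant ($B([X,Y],Z)=B(X,[Y,Z])$), and even ($B(\mathfrak{g}_{\overline 0},\mathfrak{g}_{\overline 1})=0$). It is indecomposable if $\mathfrak{g}=\mathfrak{g}_1\oplus\mathfrak{g}_2$ with $\mathfrak{g}_1,\mathfrak{g}_2$ $B$-orthogonal (graded) ideals implies $\mathfrak{g}_1=\{0\}$ or $\mathfrak{g}_2=\{0\}$. An i-isomorphism is an (even) Lie superalgebra isomorphism preserving the bilinear forms. $\mathfrak{osp}(1,2)$ is the orthosymplectic Lie superalgebra of dimension $(3|2)$ with even part $\mathfrak{sp}(2)\simeq\mathfrak{sl}(2)$. *)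

theory Defs
  imports "HOL-Analysis.Analysis"
begin

section \<open>Quadratic Lie superalgebras over the complex numbers\<close>

text \<open>
  The underlying vector space is the whole type, with an explicit scalar multiplication.
  The grading group of integers mod 2 is \<^typ>\<open>bool\<close>: \<^term>\<open>False\<close> is even, \<^term>\<open>True\<close> is odd,
  and the sum of degrees is \<^prop>\<open>p \<noteq> q\<close>. Accordingly \<open>L False\<close> and \<open>L True\<close> are the even and
  the odd part. Finite dimension is not assumed in the locales; it follows from
  \<open>dim UNIV = 5\<close>, because \<open>dim\<close> is 0 on spaces without a finite basis.
\<close>

definition koszul :: "bool \<Rightarrow> bool \<Rightarrow> complex" where
  "koszul p q = (if p \<and> q then -1 else 1)"

locale lie_superalgebra = vector_space smul
  for smul :: "complex \<Rightarrow> 'a::ab_group_add \<Rightarrow> 'a" +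
  fixes L :: "bool \<Rightarrow> 'a set"
    and br :: "'a \<Rightarrow> 'a \<Rightarrow> 'a"
  assumes subspace_L: "subspace (L p)"
    and L_inter: "L False \<inter> L True = {0}"
    and L_sum: "\<exists>x0\<in>L False. \<exists>x1\<in>L True. x = x0 + x1"
    and br_linear_left: "Vector_Spaces.linear smul smul (\<lambda>x. br x y)"
    and br_linear_right: "Vector_Spaces.linear smul smul (br x)"
    and br_graded: "x \<in> L p \<Longrightarrow> y \<in> L q \<Longrightarrow> br x y \<in> L (p \<noteq> q)"
    and br_skew: "x \<in> L p \<Longrightarrow> y \<in> L q \<Longrightarrow> br y x = - smul (koszul p q) (br x y)"
    and br_jacobi: "x \<in> L p \<Longrightarrow> y \<in> L q \<Longrightarrow> z \<in> L r \<Longrightarrow>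
      br x (br y z) = br (br x y) z + smul (koszul p q) (br y (br x z))"

locale quadratic_lie_superalgebra = lie_superalgebra smul L br
  for smul :: "complex \<Rightarrow> 'a::ab_group_add \<Rightarrow> 'a" and L br +
  fixes B :: "'a \<Rightarrow> 'a \<Rightarrow> complex"
  assumes B_linear_left: "Vector_Spaces.linear smul (*) (\<lambda>x. B x y)"
    and B_linear_right: "Vector_Spaces.linear smul (*) (B x)"
    and B_nondegenerate: "(\<And>y. B x y = 0) \<Longrightarrow> x = 0"
    and B_supersymmetric: "x \<in> L p \<Longrightarrow> y \<in> L q \<Longrightarrow> B y x = koszul p q * B x y"
    and B_invariant: "B (br x y) z = B x (br y z)"
    and B_even: "x \<in> L False \<Longrightarrow> y \<in> L True \<Longrightarrow> B x y = 0"

definition graded_ideal ::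
    "(complex \<Rightarrow> 'a::ab_group_add \<Rightarrow> 'a) \<Rightarrow> (bool \<Rightarrow> 'a set) \<Rightarrow> ('a \<Rightarrow> 'a \<Rightarrow> 'a) \<Rightarrow> 'a set \<Rightarrow> bool" where
  "graded_ideal smul L br I \<longleftrightarrow>
     module.subspace smul I \<and>
     (\<forall>x\<in>I. \<exists>x0\<in>I \<inter> L False. \<exists>x1\<in>I \<inter> L True. x = x0 + x1) \<and>
     (\<forall>x\<in>I. \<forall>y. br x y \<in> I \<and> br y x \<in> I)"

definition indecomposable ::
    "(complex \<Rightarrow> 'a::ab_group_add \<Rightarrow> 'a) \<Rightarrow> (bool \<Rightarrow> 'a set) \<Rightarrow> ('a \<Rightarrow> 'a \<Rightarrow> 'a)
      \<Rightarrow> ('a \<Rightarrow> 'a \<Rightarrow> complex) \<Rightarrow> bool" where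
  "indecomposable smul L br B \<longleftrightarrow>
     (\<forall>I J. graded_ideal smul L br I \<longrightarrow> graded_ideal smul L br J \<longrightarrow>
        I \<inter> J = {0} \<longrightarrow> (\<forall>x. \<exists>y\<in>I. \<exists>z\<in>J. x = y + z) \<longrightarrow>
        (\<forall>x\<in>I. \<forall>y\<in>J. B x y = 0) \<longrightarrow> I = {0} \<or> J = {0})"

primrec derived_series ::
    "(complex \<Rightarrow> 'a::ab_group_add \<Rightarrow> 'a) \<Rightarrow> ('a \<Rightarrow> 'a \<Rightarrow> 'a) \<Rightarrow> 'a set \<Rightarrow> nat \<Rightarrow> 'a set" where
  "derived_series smul br S 0 = S"
| "derived_series smul br S (Suc n) =
     module.span smul {br x y |x y. x \<in> derived_series smul br S n \<and> y \<in> derived_series smul br S n}"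

definition solvable ::
    "(complex \<Rightarrow> 'a::ab_group_add \<Rightarrow> 'a) \<Rightarrow> ('a \<Rightarrow> 'a \<Rightarrow> 'a) \<Rightarrow> 'a set \<Rightarrow> bool" where
  "solvable smul br S \<longleftrightarrow> (\<exists>n. derived_series smul br S n = {0})"

definition superalgebra_iso ::
    "(complex \<Rightarrow> 'a::ab_group_add \<Rightarrow> 'a) \<Rightarrow> (bool \<Rightarrow> 'a set) \<Rightarrow> ('a \<Rightarrow> 'a \<Rightarrow> 'a)
      \<Rightarrow> (complex \<Rightarrow> 'b::ab_group_add \<Rightarrow> 'b) \<Rightarrow> (bool \<Rightarrow> 'b set) \<Rightarrow> ('b \<Rightarrow> 'b \<Rightarrow> 'b)
      \<Rightarrow> ('a \<Rightarrow> 'b) \<Rightarrow> bool" where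
  "superalgebra_iso smul L br smul' L' br' f \<longleftrightarrow>
     Vector_Spaces.linear smul smul' f \<and> bij f \<and> (\<forall>p. f ` L p = L' p) \<and>
     (\<forall>x y. f (br x y) = br' (f x) (f y))"

definition isomorphic where
  "isomorphic smul L br smul' L' br' \<longleftrightarrow> (\<exists>f. superalgebra_iso smul L br smul' L' br' f)"

definition i_isomorphic where
  "i_isomorphic smul L br B smul' L' br' B' \<longleftrightarrow>
     (\<exists>f. superalgebra_iso smul L br smul' L' br' f \<and> (\<forall>x y. B' (f x) (f y) = B x y))"


section \<open>The five-dimensional nilpotent quadratic Lie algebra\<close>

definition g5_X1 :: "complex ^ 5" where "g5_X1 = axis 1 1"
definition g5_X2 :: "complex ^ 5" where "g5_X2 = axis 2 1"
definition g5_T  :: "complex ^ 5" where "g5_T  = axis 3 1"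
definition g5_Z1 :: "complex ^ 5" where "g5_Z1 = axis 4 1"
definition g5_Z2 :: "complex ^ 5" where "g5_Z2 = axis 5 1"

definition g5_part :: "bool \<Rightarrow> (complex ^ 5) set" where
  "g5_part p = (if p then {0} else UNIV)"

definition g5_bracket :: "complex ^ 5 \<Rightarrow> complex ^ 5 \<Rightarrow> complex ^ 5" where
  "g5_bracket x y =
     (x$1 * y$2 - x$2 * y$1) *s g5_T - (x$1 * y$3 - x$3 * y$1) *s g5_Z2
     + (x$2 * y$3 - x$3 * y$2) *s g5_Z1"

definition g5_form :: "complex ^ 5 \<Rightarrow> complex ^ 5 \<Rightarrow> complex" where
  "g5_form x y = x$1 * y$4 + x$4 * y$1 + x$2 * y$5 + x$5 * y$2 + x$3 * y$3"

lemmas g5_basis_defs = g5_X1_def g5_X2_def g5_T_def g5_Z1_def g5_Z2_def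

lemma g5_bracket_basis:
  "g5_bracket g5_X1 g5_X2 = g5_T" "g5_bracket g5_X1 g5_T = - g5_Z2" "g5_bracket g5_X2 g5_T = g5_Z1"
  "g5_bracket g5_X1 g5_Z1 = 0" "g5_bracket g5_X1 g5_Z2 = 0"
  "g5_bracket g5_X2 g5_Z1 = 0" "g5_bracket g5_X2 g5_Z2 = 0"
  "g5_bracket g5_T g5_Z1 = 0" "g5_bracket g5_T g5_Z2 = 0" "g5_bracket g5_Z1 g5_Z2 = 0"
  by (simp_all add: g5_bracket_def g5_basis_defs axis_def vec_eq_iff)

lemma exhaust_5: "x = 1 \<or> x = 2 \<or> x = 3 \<or> x = 4 \<or> x = 5" for x :: 5
proof (induct x)
  case (of_int z)
  then have "z = 0 \<or> z = 1 \<or> z = 2 \<or> z = 3 \<or> z = 4" by fastforce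
  then show ?case by auto
qed

lemma forall_5: "(\<forall>i::5. P i) \<longleftrightarrow> P 1 \<and> P 2 \<and> P 3 \<and> P 4 \<and> P 5"
  by (metis exhaust_5)

lemma g5_bracket_nth:
  "g5_bracket x y $ 1 = 0" "g5_bracket x y $ 2 = 0"
  "g5_bracket x y $ 3 = x$1 * y$2 - x$2 * y$1"
  "g5_bracket x y $ 4 = x$2 * y$3 - x$3 * y$2"
  "g5_bracket x y $ 5 = x$3 * y$1 - x$1 * y$3"
  by (simp_all add: g5_bracket_def g5_basis_defs axis_def)

lemma quadratic_g5: "quadratic_lie_superalgebra (*s) g5_part g5_bracket g5_form"
proof -
  have lin: "Vector_Spaces.linear (*s) (*s) f \<longleftrightarrow> (\<forall>x y. f (x + y) = f x + f y) \<and> (\<forall>c x. f (c *s x) = c *s f x)"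
    for f :: "complex ^ 5 \<Rightarrow> complex ^ 5"
    using vec.vector_space_axioms by (auto simp: Vector_Spaces.linear_iff)
  have vs: "vector_space ((*) :: complex \<Rightarrow> complex \<Rightarrow> complex)"
    by unfold_locales (auto simp: algebra_simps)
  have linB: "Vector_Spaces.linear (*s) (*) f \<longleftrightarrow> (\<forall>x y. f (x + y) = f x + f y) \<and> (\<forall>c x. f (c *s x) = c * f x)"
    for f :: "complex ^ 5 \<Rightarrow> complex"
    using vs vec.vector_space_axioms
    by (auto simp: Vector_Spaces.linear_iff)
  have nondeg: "x = 0" if "\<And>y. g5_form x y = 0" for x
    using that[of "axis 1 1"] that[of "axis 2 1"] that[of "axis 3 1"] that[of "axis 4 1"] that[of "axis 5 1"]
    by (simp add: vec_eq_iff forall_5 g5_form_def axis_def)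
  show ?thesis
  proof (intro quadratic_lie_superalgebra.intro lie_superalgebra.intro lie_superalgebra_axioms.intro
      quadratic_lie_superalgebra_axioms.intro vec.vector_space_axioms)
    fix x y z u :: "complex ^ 5" and p q r
    show "vec.subspace (g5_part p)" "g5_part False \<inter> g5_part True = {0}"
      "\<exists>x0\<in>g5_part False. \<exists>x1\<in>g5_part True. x = x0 + x1"
      by (auto simp: g5_part_def)
    show "Vector_Spaces.linear (*s) (*s) (\<lambda>x. g5_bracket x y)" "Vector_Spaces.linear (*s) (*s) (g5_bracket x)"
      by (simp_all add: lin vec_eq_iff forall_5 g5_bracket_nth algebra_simps)
    show "Vector_Spaces.linear (*s) (*) (\<lambda>x. g5_form x y)" "Vector_Spaces.linear (*s) (*) (g5_form x)"
      by (simp_all add: linB g5_form_def algebra_simps)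
    show "g5_form (g5_bracket x y) z = g5_form x (g5_bracket y z)"
      by (simp add: g5_form_def g5_bracket_nth algebra_simps)
    show "x \<in> g5_part False \<Longrightarrow> y \<in> g5_part True \<Longrightarrow> g5_form x y = 0"
      by (auto simp: g5_part_def g5_form_def)
    show "(\<And>y. g5_form u y = 0) \<Longrightarrow> u = 0"
      by (rule nondeg)
    assume xy: "x \<in> g5_part p" "y \<in> g5_part q"
    then show "g5_bracket x y \<in> g5_part (p \<noteq> q)"
      "g5_bracket y x = - (koszul p q *s g5_bracket x y)" "g5_form y x = koszul p q * g5_form x y"
      by (auto simp: g5_part_def vec_eq_iff forall_5 g5_bracket_nth g5_form_def koszul_def split: if_splits)
    assume "z \<in> g5_part r"
    with xy show "g5_bracket x (g5_bracket y z) =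
        g5_bracket (g5_bracket x y) z + koszul p q *s g5_bracket y (g5_bracket x z)"
      by (auto simp: g5_part_def vec_eq_iff forall_5 g5_bracket_nth koszul_def algebra_simps split: if_splits)
  qed
qed


section \<open>The orthosymplectic Lie superalgebra \<open>osp(1,2)\<close>\<close>

text \<open>
  The defining representation is the superspace of dimension \<open>(1|2)\<close> on \<^typ>\<open>complex ^ 3\<close>: the
  coordinate 1 is even, the coordinates 2 and 3 are odd. A matrix is an endomorphism of this
  superspace and splits into its even and its odd component.
\<close>

definition coord_parity :: "3 \<Rightarrow> bool" where
  "coord_parity i \<longleftrightarrow> i \<noteq> 1"

definition homogeneous_vectors :: "bool \<Rightarrow> (complex ^ 3) set" where
  "homogeneous_vectors p = {u. \<forall>i. coord_parity i \<noteq> p \<longrightarrow> u $ i = 0}"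

definition mat_component :: "bool \<Rightarrow> complex ^ 3 ^ 3 \<Rightarrow> complex ^ 3 ^ 3" where
  "mat_component p A = (\<chi> i j. if (coord_parity i \<noteq> coord_parity j) = p then A $ i $ j else 0)"

definition mat_scale :: "complex \<Rightarrow> complex ^ 3 ^ 3 \<Rightarrow> complex ^ 3 ^ 3" where
  "mat_scale c A = (\<chi> i j. c * A $ i $ j)"

definition supercommutator :: "complex ^ 3 ^ 3 \<Rightarrow> complex ^ 3 ^ 3 \<Rightarrow> complex ^ 3 ^ 3" where
  "supercommutator A C =
     (\<Sum>p\<in>UNIV. \<Sum>q\<in>UNIV. mat_component p A ** mat_component q C
        - mat_scale (koszul p q) (mat_component q C ** mat_component p A))"

text \<open>The even supersymmetric form: symmetric on the even line, symplectic on the odd plane.\<close>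

definition osp_form :: "complex ^ 3 \<Rightarrow> complex ^ 3 \<Rightarrow> complex" where
  "osp_form u v = u$1 * v$1 + u$2 * v$3 - u$3 * v$2"

definition osp12_mats :: "(complex ^ 3 ^ 3) set" where
  "osp12_mats = {A. \<forall>p q. \<forall>u\<in>homogeneous_vectors q. \<forall>v.
     osp_form (mat_component p A *v u) v = - koszul p q * osp_form u (mat_component p A *v v)}"

lemma osp12_mats_iff:
  "A \<in> osp12_mats \<longleftrightarrow>
     A$1$1 = 0 \<and> A$3$3 = - A$2$2 \<and> A$1$2 = A$3$1 \<and> A$1$3 = - A$2$1"
proof
  assume *: "A \<in> osp12_mats"
  have h: "axis 1 1 \<in> homogeneous_vectors False" "axis 2 1 \<in> homogeneous_vectors True"
    by (auto simp: homogeneous_vectors_def coord_parity_def axis_def forall_3)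
  have E: "osp_form (mat_component p A *v u) v = - koszul p q * osp_form u (mat_component p A *v v)"
    if "u \<in> homogeneous_vectors q" for p q u v
    using * that by (auto simp: osp12_mats_def)
  note expand = osp_form_def mat_component_def matrix_vector_mult_def sum_3 axis_def coord_parity_def koszul_def
  show "A$1$1 = 0 \<and> A$3$3 = - A$2$2 \<and> A$1$2 = A$3$1 \<and> A$1$3 = - A$2$1"
    using E[OF h(1), of False "axis 1 1"] E[OF h(1), of True "axis 2 1"]
      E[OF h(1), of True "axis 3 1"] E[OF h(2), of False "axis 3 1"]
    by (simp add: expand eq_neg_iff_add_eq_0 add.commute)
next
  assume "A$1$1 = 0 \<and> A$3$3 = - A$2$2 \<and> A$1$2 = A$3$1 \<and> A$1$3 = - A$2$1"
  then show "A \<in> osp12_mats"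
    by (auto simp: osp12_mats_def homogeneous_vectors_def osp_form_def mat_component_def
        matrix_vector_mult_def sum_3 coord_parity_def koszul_def forall_3 algebra_simps)
qed

lemma supercommutator_nth:
  "supercommutator A C $ i $ j =
     (\<Sum>k\<in>UNIV. A$i$k * C$k$j
        - koszul (coord_parity i \<noteq> coord_parity k) (coord_parity k \<noteq> coord_parity j) * C$i$k * A$k$j)"
  using exhaust_3[of i] exhaust_3[of j]
  by (auto simp: supercommutator_def UNIV_bool matrix_matrix_mult_def mat_component_def mat_scale_def
      koszul_def coord_parity_def sum_3)

typedef osp12 = osp12_mats
  by (rule exI[of _ 0]) (simp add: osp12_mats_iff)

setup_lifting type_definition_osp12

instantiation osp12 :: ab_group_add
begin

lift_definition zero_osp12 :: osp12 is 0
  by (simp add: osp12_mats_iff)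
lift_definition plus_osp12 :: "osp12 \<Rightarrow> osp12 \<Rightarrow> osp12" is "(+)"
  by (simp add: osp12_mats_iff)
lift_definition minus_osp12 :: "osp12 \<Rightarrow> osp12 \<Rightarrow> osp12" is "(-)"
  by (simp add: osp12_mats_iff)
lift_definition uminus_osp12 :: "osp12 \<Rightarrow> osp12" is uminus
  by (simp add: osp12_mats_iff)

instance
  by standard (transfer; simp)+

end

lift_definition osp12_scale :: "complex \<Rightarrow> osp12 \<Rightarrow> osp12" is mat_scale
  by (simp add: osp12_mats_iff mat_scale_def)

lift_definition osp12_bracket :: "osp12 \<Rightarrow> osp12 \<Rightarrow> osp12" is supercommutator
  by (simp add: osp12_mats_iff supercommutator_nth sum_3 coord_parity_def koszul_def algebra_simps)

definition osp12_part :: "bool \<Rightarrow> osp12 set" where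
  "osp12_part p = {X. mat_component p (Rep_osp12 X) = Rep_osp12 X}"

lemma osp12_part_iff:
  "X \<in> osp12_part p \<longleftrightarrow>
     (\<forall>i j. (coord_parity i \<noteq> coord_parity j) \<noteq> p \<longrightarrow> Rep_osp12 X $ i $ j = 0)"
  by (auto simp: osp12_part_def mat_component_def vec_eq_iff)

lemma lie_superalgebra_osp12: "lie_superalgebra osp12_scale osp12_part osp12_bracket"
proof -
  have Rep: "Rep_osp12 X \<in> osp12_mats" for X
    by (rule Rep_osp12)
  have vs: "vector_space osp12_scale"
    by unfold_locales (transfer; simp add: mat_scale_def vec_eq_iff algebra_simps)+
  interpret vector_space osp12_scale by (rule vs)
  note reps = plus_osp12.rep_eq minus_osp12.rep_eq zero_osp12.rep_eq uminus_osp12.rep_eq osp12_scale.rep_eq osp12_bracket.rep_eq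
  note ext = Rep_osp12_inject[symmetric] reps vec_eq_iff forall_3 mat_scale_def supercommutator_nth sum_3
    coord_parity_def koszul_def
  have component: "mat_component p A \<in> osp12_mats" if "A \<in> osp12_mats" for p A
    using that by (auto simp: osp12_mats_iff mat_component_def coord_parity_def)
  have split: "\<exists>x0\<in>osp12_part False. \<exists>x1\<in>osp12_part True. x = x0 + x1" for x
  proof (intro bexI)
    let ?X = "\<lambda>p. Abs_osp12 (mat_component p (Rep_osp12 x))"
    have R: "Rep_osp12 (?X p) = mat_component p (Rep_osp12 x)" for p
      by (rule Abs_osp12_inverse, rule component, rule Rep)
    show "x = ?X False + ?X True"
      unfolding Rep_osp12_inject[symmetric] reps R by (simp add: vec_eq_iff mat_component_def)
    show "?X False \<in> osp12_part False" "?X True \<in> osp12_part True"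
      unfolding osp12_part_iff R by (auto simp: mat_component_def)
  qed
  show ?thesis
  proof (intro lie_superalgebra.intro lie_superalgebra_axioms.intro vs)
    fix x y z :: osp12 and p q r
    show "subspace (osp12_part p)"
      by (auto simp: subspace_def osp12_part_iff reps mat_scale_def)
    show "osp12_part False \<inter> osp12_part True = {0}"
      by (auto simp: osp12_part_iff ext)
    show "\<exists>x0\<in>osp12_part False. \<exists>x1\<in>osp12_part True. x = x0 + x1"
      by (rule split)
    show "Vector_Spaces.linear osp12_scale osp12_scale (\<lambda>x. osp12_bracket x y)"
      "Vector_Spaces.linear osp12_scale osp12_scale (osp12_bracket x)"
      by (simp_all add: Vector_Spaces.linear_iff vs ext algebra_simps)
    assume xy: "x \<in> osp12_part p" "y \<in> osp12_part q"
    then show "osp12_bracket x y \<in> osp12_part (p \<noteq> q)"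
      "osp12_bracket y x = - osp12_scale (koszul p q) (osp12_bracket x y)"
      by (cases p; cases q; auto simp: osp12_part_iff ext)+
    assume "z \<in> osp12_part r"
    with xy show "osp12_bracket x (osp12_bracket y z) =
        osp12_bracket (osp12_bracket x y) z + osp12_scale (koszul p q) (osp12_bracket y (osp12_bracket x z))"
      by (cases p; cases q; cases r; simp add: osp12_part_iff ext algebra_simps)
  qed
qed

end

theory Submission
  imports Defs
begin

text \<open>
  Indecomposability makes every central even vector isotropic. The odd part is symplectic, so the
  dimensions of the two parts are \<open>(5|0)\<close>, \<open>(3|2)\<close> or \<open>(1|4)\<close>.

  For \<open>(1|4)\<close> the Jacobi identity of odd elements forces the even line to be central and
  non-isotropic.

  For \<open>(3|2)\<close> let \<open>e\<close>, \<open>f\<close> be a symplectic basis of the odd part. All brackets of the odd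
  vectors with \<open>[e,e]\<close>, \<open>[e,f]\<close>, \<open>[f,f]\<close> depend on one scalar \<open>\<alpha>\<close>. If \<open>\<alpha> \<noteq> 0\<close>, these three
  vectors form a basis of the even part, which is perfect, and rescaling yields \<open>osp(1,2)\<close>.
  If \<open>\<alpha> = 0\<close>, they span an isotropic space acting trivially on the odd part, and a Witt basis of
  the even part shows that the algebra decomposes.

  For \<open>(5|0)\<close> a solvable algebra is not perfect, hence has a central vector \<open>z\<close>. The form
  \<open>B([x,y],w)\<close> is an alternating three-form on the four-dimensional quotient by \<open>z\<close>, so it has a
  kernel there, which gives a second central vector. In a Witt basis adapted to the two central
  vectors only one structure constant is left, and it can be scaled to 1.
\<close>

text \<open>The explicit maps below start from the concrete models, whose elements have coordinates.
  Inverting them gives the direction that \<open>isomorphic\<close> and \<open>i_isomorphic\<close>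
  ask for.\<close>

lemma superalgebra_iso_inverse:
  assumes "superalgebra_iso smul' L' br' smul L br f"
  shows "superalgebra_iso smul L br smul' L' br' (inv f)"
proof -
  have lin: "Vector_Spaces.linear smul' smul f" and bij: "bij f" and L: "\<And>p. f ` L' p = L p"
    and br: "\<And>x y. f (br' x y) = br (f x) (f y)"
    using assms by (auto simp: superalgebra_iso_def)
  have vs: "vector_space smul" "vector_space smul'"
    using lin by (simp_all add: Vector_Spaces.linear_iff)
  have f_inv: "f (inv f x) = x" for x
    using bij by (simp add: bij_is_surj surj_f_inv_f)
  have inv_f: "inv f (f x) = x" for x
    using bij by (simp add: bij_is_inj)
  have add: "f (x + y) = f x + f y" and scale: "f (smul' c x) = smul c (f x)" for x y c
    using lin by (simp_all add: Vector_Spaces.linear_iff)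
  have "inv f (x + y) = inv f x + inv f y" for x y
    by (metis add f_inv inv_f)
  moreover have "inv f (smul c x) = smul' c (inv f x)" for x c
    by (metis scale f_inv inv_f)
  ultimately have "Vector_Spaces.linear smul smul' (inv f)"
    by (simp add: Vector_Spaces.linear_iff vs)
  moreover have "inv f ` L p = L' p" for p
    by (metis L bij bij_is_inj image_inv_f_f)
  moreover have "inv f (br x y) = br' (inv f x) (inv f y)" for x y
    by (metis br f_inv inv_f)
  ultimately show ?thesis
    by (simp add: superalgebra_iso_def bij bij_imp_bij_inv)
qed

section \<open>Orthogonal splitting\<close>

context quadratic_lie_superalgebra
begin

section \<open>Bilinear calculus and the sign rules for even and odd vectors\<close>

lemma vector_space_mult_complex: "vector_space ((*) :: complex \<Rightarrow> complex \<Rightarrow> complex)"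
  by unfold_locales (auto simp: algebra_simps)

lemma B_add_left: "B (x + y) z = B x z + B y z"
  and B_scale_left: "B (smul c x) z = c * B x z"
  using B_linear_left by (simp_all add: Vector_Spaces.linear_iff)

lemma B_add_right: "B z (x + y) = B z x + B z y"
  and B_scale_right: "B z (smul c x) = c * B z x"
  using B_linear_right by (simp_all add: Vector_Spaces.linear_iff)

lemma B_zero_left: "B 0 z = 0" and B_zero_right: "B z 0 = 0"
  using B_scale_left[of 0 0 z] B_scale_right[of z 0 0] by simp_all

lemma B_minus_left: "B (- x) z = - B x z" and B_minus_right: "B z (- x) = - B z x"
  using B_scale_left[of "-1" x z] B_scale_right[of z "-1" x] by simp_all

lemma B_diff_left: "B (x - y) z = B x z - B y z" and B_diff_right: "B z (x - y) = B z x - B z y"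
  using B_add_left[of x "- y" z] B_add_right[of z x "- y"] by (simp_all add: B_minus_left B_minus_right)

lemmas B_simps = B_add_left B_scale_left B_add_right B_scale_right B_zero_left B_zero_right
  B_minus_left B_minus_right B_diff_left B_diff_right

lemma br_add_left: "br (x + y) z = br x z + br y z"
  and br_scale_left: "br (smul c x) z = smul c (br x z)"
  using br_linear_left by (simp_all add: Vector_Spaces.linear_iff)

lemma br_add_right: "br z (x + y) = br z x + br z y"
  and br_scale_right: "br z (smul c x) = smul c (br z x)"
  using br_linear_right by (simp_all add: Vector_Spaces.linear_iff)

lemma br_zero_left: "br 0 z = 0" and br_zero_right: "br z 0 = 0"
  using br_scale_left[of 0 0 z] br_scale_right[of z 0 0] by simp_all

lemma br_minus_left: "br (- x) z = - br x z" and br_minus_right: "br z (- x) = - br z x"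
  using br_scale_left[of "-1" x z] br_scale_right[of z "-1" x] by simp_all

lemma br_diff_left: "br (x - y) z = br x z - br y z" and br_diff_right: "br z (x - y) = br z x - br z y"
  using br_add_left[of x "- y" z] br_add_right[of z x "- y"] by (simp_all add: br_minus_left br_minus_right)

lemmas br_simps = br_add_left br_scale_left br_add_right br_scale_right br_zero_left br_zero_right
  br_minus_left br_minus_right br_diff_left br_diff_right

lemma br_even_swap: "x \<in> L False \<Longrightarrow> y \<in> L p \<Longrightarrow> br y x = - br x y"
  using br_skew[of x False y p] by (simp add: koszul_def)

lemma br_odd_swap: "x \<in> L True \<Longrightarrow> y \<in> L True \<Longrightarrow> br y x = br x y"
  using br_skew[of x True y True] by (simp add: koszul_def)

lemma br_even: "x \<in> L False \<Longrightarrow> y \<in> L p \<Longrightarrow> br x y \<in> L p"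
  using br_graded[of x False y p] by (cases p) auto

lemma br_odd: "x \<in> L True \<Longrightarrow> y \<in> L True \<Longrightarrow> br x y \<in> L False"
  using br_graded[of x True y True] by auto

lemma B_even_sym: "x \<in> L False \<Longrightarrow> y \<in> L p \<Longrightarrow> B y x = B x y"
  using B_supersymmetric[of x False y p] by (simp add: koszul_def)

lemma B_odd_skew: "x \<in> L True \<Longrightarrow> y \<in> L True \<Longrightarrow> B y x = - B x y"
  using B_supersymmetric[of x True y True] by (simp add: koszul_def)

lemma B_odd_even: "x \<in> L True \<Longrightarrow> y \<in> L False \<Longrightarrow> B x y = 0"
  using B_even[of y x] B_even_sym[of y x True] by simp

lemma br_even_self: "x \<in> L False \<Longrightarrow> br x x = 0"
proof -
  assume "x \<in> L False"
  then have "br x x + br x x = 0"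
    using br_even_swap[of x x False] by (simp add: eq_neg_iff_add_eq_0)
  then have "smul 2 (br x x) = 0"
    by (metis one_add_one scale_left_distrib scale_one)
  then show ?thesis by simp
qed

lemma B_odd_self: "x \<in> L True \<Longrightarrow> B x x = 0"
  using B_odd_skew[of x x] by simp

text \<open>Only the left radical is tested. On the subspaces considered below \<open>B\<close> is
  symmetric or skew, so the right radical is the same.\<close>

definition nondegenerate :: "'a set \<Rightarrow> bool" where
  "nondegenerate U \<longleftrightarrow> subspace U \<and> (\<forall>x\<in>U. (\<forall>y\<in>U. B x y = 0) \<longrightarrow> x = 0)"

lemma nondegenerateD: "nondegenerate U \<Longrightarrow> x \<in> U \<Longrightarrow> (\<And>y. y \<in> U \<Longrightarrow> B x y = 0) \<Longrightarrow> x = 0"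
  by (auto simp: nondegenerate_def)

lemma nondegenerate_subspace: "nondegenerate U \<Longrightarrow> subspace U"
  by (auto simp: nondegenerate_def)

text \<open>The two parts are orthogonal, so a vector of one part that is orthogonal to that part is
  orthogonal to everything.\<close>

lemma nondegenerate_L: "nondegenerate (L p)"
proof -
  have "x = 0" if x: "x \<in> L p" "\<And>y. y \<in> L p \<Longrightarrow> B x y = 0" for x
  proof (rule B_nondegenerate)
    fix y
    obtain y0 y1 where "y0 \<in> L False" "y1 \<in> L True" "y = y0 + y1"
      using L_sum[of y] by blast
    then show "B x y = 0"
      using x by (cases p) (auto simp: B_simps B_even B_odd_even)
  qed
  then show ?thesis
    by (auto simp: nondegenerate_def subspace_L)
qed

lemma exists_paired:
  assumes U: "nondegenerate U" and x: "x \<in> U" "x \<noteq> 0"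
  shows "\<exists>y\<in>U. B x y = 1"
proof -
  obtain y where y: "y \<in> U" "B x y \<noteq> 0"
    using nondegenerateD[OF U x(1)] x(2) by blast
  then have "smul (1 / B x y) y \<in> U" "B x (smul (1 / B x y) y) = 1"
    by (simp_all add: subspace_scale[OF nondegenerate_subspace[OF U]] B_simps)
  then show ?thesis by blast
qed

text \<open>If every \<open>B u u\<close> vanished, polarisation would make \<open>B\<close> zero on
  \<open>U\<close>. A non-isotropic vector is then normalised by a complex square root.\<close>

lemma exists_unit:
  assumes U: "nondegenerate U" "U \<noteq> {0}" and sym: "\<And>x y. x \<in> U \<Longrightarrow> y \<in> U \<Longrightarrow> B y x = B x y"
  shows "\<exists>u\<in>U. B u u = 1"
proof -
  note sub = nondegenerate_subspace[OF U(1)]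
  have "\<exists>u\<in>U. B u u \<noteq> 0"
  proof (rule ccontr)
    assume *: "\<not> (\<exists>u\<in>U. B u u \<noteq> 0)"
    have "B x y = 0" if "x \<in> U" "y \<in> U" for x y
    proof -
      have "B (x + y) (x + y) = 0" "B x x = 0" "B y y = 0"
        using * that subspace_add[OF sub] by auto
      then show ?thesis
        using sym[OF that] by (simp add: B_simps)
    qed
    then have "U \<subseteq> {0}"
      using nondegenerateD[OF U(1)] by auto
    then show False
      using U(2) subspace_0[OF sub] by auto
  qed
  then obtain u where u: "u \<in> U" "B u u \<noteq> 0" by blast
  let ?c = "1 / csqrt (B u u)"
  have "?c * (?c * B u u) = 1"
    using u(2) by (simp flip: power2_eq_square add: field_simps)
  then have "B (smul ?c u) (smul ?c u) = 1"
    by (simp only: B_simps)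
  then show ?thesis
    using subspace_scale[OF sub u(1)] by blast
qed

lemma exists_hyperbolic:
  assumes U: "nondegenerate U" and sym: "\<And>x y. x \<in> U \<Longrightarrow> y \<in> U \<Longrightarrow> B y x = B x y"
    and x: "x \<in> U" "x \<noteq> 0" "B x x = 0"
  shows "\<exists>y\<in>U. B x y = 1 \<and> B y y = 0"
proof -
  note sub = nondegenerate_subspace[OF U(1)]
  obtain y where y: "y \<in> U" "B x y = 1"
    using exists_paired[OF U x(1,2)] by blast
  \<comment> \<open>Since \<open>x\<close> is isotropic, subtracting a multiple of it keeps
    \<open>B x y = 1\<close>; this multiple cancels \<open>B y y\<close>.\<close>
  let ?y = "y - smul (B y y / 2) x"
  have "?y \<in> U"
    using y x by (simp add: subspace_diff[OF sub] subspace_scale[OF sub])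
  moreover have "B x ?y = 1" "B ?y ?y = 0"
    using y x sym[of x y] by (simp_all add: B_simps)
  ultimately show ?thesis by blast
qed

end

section \<open>Finite dimension: splitting off lines and hyperbolic planes, representing
  functionals\<close>

locale finite_quadratic_lie_superalgebra = quadratic_lie_superalgebra +
  assumes finite_basis: "\<exists>b. finite b \<and> independent b \<and> span b = UNIV"
begin

sublocale finite_dimensional_vector_space smul "SOME b. finite b \<and> independent b \<and> span b = UNIV"
  using someI_ex[OF finite_basis] by unfold_locales auto

lemma dim_L: "dim (L False) + dim (L True) = dim (UNIV :: 'a set)"
proof -
  have "{x + y |x y. x \<in> L False \<and> y \<in> L True} = UNIV"
    using L_sum by blast
  then show ?thesis
    using dim_sums_Int[OF subspace_L subspace_L, of False True] by (simp add: L_inter)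
qed

lemma nonzero_of_dim: "dim U \<noteq> 0 \<Longrightarrow> U \<noteq> {0}"
  by (erule contrapos_nn) simp

lemma dim_zero_eq: "subspace U \<Longrightarrow> dim U = 0 \<longleftrightarrow> U = {0}"
  by (auto dest: subspace_0)

text \<open>Subtracting \<open>smul (B x u) u\<close> projects \<open>U\<close> onto the complement
  of \<open>u\<close>. A vector of the complement pairs with \<open>y\<close> as it does with the
  projection of \<open>y\<close>, so nondegeneracy is inherited.\<close>

lemma split_unit:
  assumes U: "nondegenerate U" and sym: "\<And>x y. x \<in> U \<Longrightarrow> y \<in> U \<Longrightarrow> B y x = B x y"
    and u: "u \<in> U" "B u u = 1"
  shows "nondegenerate {x\<in>U. B x u = 0}" "dim U = Suc (dim {x\<in>U. B x u = 0})"
proof -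
  let ?U = "{x\<in>U. B x u = 0}"
  note sub = nondegenerate_subspace[OF U(1)]
  have sub': "subspace ?U"
    using sub by (auto simp: subspace_def B_simps)
  have dec: "x - smul (B x u) u \<in> ?U" if "x \<in> U" for x
    using that u by (auto simp: B_simps subspace_diff[OF sub] subspace_scale[OF sub])
  have "x = 0" if x: "x \<in> ?U" "\<And>y. y \<in> ?U \<Longrightarrow> B x y = 0" for x
  proof (rule nondegenerateD[OF U])
    fix y assume "y \<in> U"
    then show "B x y = 0"
      using x(2)[OF dec, of y] x(1) by (simp add: B_simps)
  qed (use x in auto)
  with sub' show "nondegenerate ?U"
    by (auto simp: nondegenerate_def)
  have "U = {x + y |x y. x \<in> span {u} \<and> y \<in> ?U}"
  proof
    show "U \<subseteq> {x + y |x y. x \<in> span {u} \<and> y \<in> ?U}"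
    proof
      fix x assume "x \<in> U"
      moreover have "x = smul (B x u) u + (x - smul (B x u) u)" by simp
      ultimately show "x \<in> {x + y |x y. x \<in> span {u} \<and> y \<in> ?U}"
        using dec by (blast intro: span_scale span_base)
    qed
    show "{x + y |x y. x \<in> span {u} \<and> y \<in> ?U} \<subseteq> U"
      using u by (auto simp: span_singleton intro!: subspace_add[OF sub] subspace_scale[OF sub])
  qed
  moreover have "span {u} \<inter> ?U = {0}"
  proof -
    have "x = 0" if "x \<in> span {u}" "x \<in> ?U" for x
      using that u by (auto simp: span_singleton B_simps)
    then show ?thesis
      using subspace_0[OF sub'] by (auto simp: span_zero)
  qed
  moreover have "u \<noteq> 0"
    using u by (auto simp: B_simps)
  ultimately show "dim U = Suc (dim ?U)"
    using dim_sums_Int[OF subspace_span sub', of "{u}"] by simp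
qed

text \<open>The sign \<open>s\<close> treats two cases at once: 1 for the symmetric form on even
  vectors, -1 for the skew form on odd vectors.\<close>

lemma split_hyperbolic:
  assumes U: "nondegenerate U" and sym: "\<And>x y. x \<in> U \<Longrightarrow> y \<in> U \<Longrightarrow> B y x = s * B x y"
    and s: "s = 1 \<or> s = -1"
    and u: "u \<in> U" "B u u = 0" and v: "v \<in> U" "B v v = 0" and uv: "B u v = 1"
  shows "nondegenerate {x\<in>U. B x u = 0 \<and> B x v = 0}"
    "dim U = Suc (Suc (dim {x\<in>U. B x u = 0 \<and> B x v = 0}))"
proof -
  let ?U = "{x\<in>U. B x u = 0 \<and> B x v = 0}"
  note sub = nondegenerate_subspace[OF U(1)]
  have vu: "B v u = s"
    using sym[OF u(1) v(1)] uv by simp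
  have ss: "s * s = 1"
    using s by auto
  have sub': "subspace ?U"
    using sub by (auto simp: subspace_def B_simps)
  \<comment> \<open>This is the projection onto the plane of \<open>u\<close> and \<open>v\<close>.
    The factor \<open>s\<close> compensates \<open>B v u = s\<close>, because
    \<open>s * s = 1\<close>.\<close>
  let ?d = "\<lambda>x. smul (B x v) u + smul (s * B x u) v"
  have dec: "x - ?d x \<in> ?U" if "x \<in> U" for x
    using that u v vu uv ss by (auto simp: B_simps subspace_diff[OF sub] subspace_add[OF sub] subspace_scale[OF sub])
  have "x = 0" if x: "x \<in> ?U" "\<And>y. y \<in> ?U \<Longrightarrow> B x y = 0" for x
  proof (rule nondegenerateD[OF U])
    fix y assume "y \<in> U"
    then show "B x y = 0"
      using x(2)[OF dec, of y] x(1) by (simp add: B_simps)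
  qed (use x in auto)
  with sub' show "nondegenerate ?U"
    by (auto simp: nondegenerate_def)
  have span: "x \<in> span {u, v} \<longleftrightarrow> (\<exists>a b. x = smul a u + smul b v)" for x
  proof
    show "\<exists>a b. x = smul a u + smul b v" if "x \<in> span {u, v}"
      using that unfolding span_breakdown_eq span_singleton by (auto simp: diff_eq_eq add.commute) blast
    show "x \<in> span {u, v}" if "\<exists>a b. x = smul a u + smul b v"
      using that by (blast intro: span_add span_scale span_base)
  qed
  have "U = {x + y |x y. x \<in> span {u, v} \<and> y \<in> ?U}"
  proof
    show "U \<subseteq> {x + y |x y. x \<in> span {u, v} \<and> y \<in> ?U}"
    proof
      fix x assume "x \<in> U"
      moreover have "x = ?d x + (x - ?d x)" by simp
      ultimately show "x \<in> {x + y |x y. x \<in> span {u, v} \<and> y \<in> ?U}"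
        using dec[OF \<open>x \<in> U\<close>] by (auto simp only: span mem_Collect_eq)
    qed
    show "{x + y |x y. x \<in> span {u, v} \<and> y \<in> ?U} \<subseteq> U"
      using u v by (auto simp: span intro!: subspace_add[OF sub] subspace_scale[OF sub])
  qed
  moreover have "span {u, v} \<inter> ?U = {0}"
  proof -
    have "x = 0" if x: "x \<in> span {u, v}" "x \<in> ?U" for x
    proof -
      obtain a b where "x = smul a u + smul b v"
        using x(1) unfolding span by blast
      then show ?thesis
        using x(2) u v uv vu s by (auto simp: B_simps)
    qed
    then show ?thesis
      using subspace_0[OF sub'] by (auto simp: span_zero)
  qed
  moreover have "u \<noteq> v"
    using u uv by auto
  moreover have "v \<noteq> 0"
    using uv by (auto simp: B_simps)
  have "u \<notin> span {v}"
    using v uv by (auto simp: span_singleton B_simps)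
  then have "independent {u, v}"
    using \<open>v \<noteq> 0\<close> by (simp add: independent_insert)
  ultimately show "dim U = Suc (Suc (dim ?U))"
    using dim_sums_Int[OF subspace_span sub', of "{u, v}"] dim_eq_card_independent[of "{u, v}"] by simp
qed

text \<open>Induction on the dimension, splitting off a unit vector each time. It serves to turn a
  functional that vanishes on brackets into a central vector.\<close>

lemma riesz:
  assumes "nondegenerate U" and "\<And>x y. x \<in> U \<Longrightarrow> y \<in> U \<Longrightarrow> B y x = B x y"
    and f: "Vector_Spaces.linear smul (*) f"
  shows "\<exists>z\<in>U. \<forall>x\<in>U. f x = B z x"
  using assms(1,2)
proof (induction "dim U" arbitrary: U)
  case 0
  then have "U = {0}"
    using dim_zero_eq[OF nondegenerate_subspace] by simp
  moreover have "f 0 = 0"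
  proof -
    have "f (smul 0 0) = 0 * f 0"
      using f by (simp only: Vector_Spaces.linear_iff)
    then show ?thesis by simp
  qed
  ultimately show ?case by (auto simp: B_simps)
next
  case (Suc n)
  note sub = nondegenerate_subspace[OF Suc.prems(1)]
  have "U \<noteq> {0}"
    using Suc.hyps(2) dim_zero_eq[OF sub] by linarith
  then obtain u where u: "u \<in> U" "B u u = 1"
    using exists_unit[OF Suc.prems(1)] Suc.prems(2) by auto
  let ?U = "{x\<in>U. B x u = 0}"
  have "nondegenerate ?U" "dim U = Suc (dim ?U)"
    by (rule split_unit[OF Suc.prems(1) _ u]; rule Suc.prems(2); assumption)+
  then have "n = dim ?U" "nondegenerate ?U"
    using Suc.hyps(2) by linarith+
  then obtain z where z: "z \<in> ?U" "\<forall>x\<in>?U. f x = B z x"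
    using Suc.hyps(1)[of ?U] Suc.prems(2) by auto
  \<comment> \<open>The vector \<open>z\<close> represents \<open>f\<close> on the complement of
    \<open>u\<close>; its missing component along \<open>u\<close> has coefficient
    \<open>f u\<close>, as \<open>B u u = 1\<close>.\<close>
  have "f x = B (z + smul (f u) u) x" if x: "x \<in> U" for x
  proof -
    have "x - smul (B x u) u \<in> ?U"
      using x u by (auto simp: B_simps subspace_diff[OF sub] subspace_scale[OF sub])
    then have "f (x - smul (B x u) u) = B z (x - smul (B x u) u)"
      using z by blast
    moreover have "f ((x - smul (B x u) u) + smul (B x u) u) = f (x - smul (B x u) u) + B x u * f u"
      using f by (simp only: Vector_Spaces.linear_iff)
    moreover have "B z u = 0" "B u x = B x u"
      using z Suc.prems(2) x u by auto
    ultimately show ?thesis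
      by (simp add: B_simps algebra_simps)
  qed
  moreover have "z + smul (f u) u \<in> U"
    using z u by (auto intro!: subspace_add[OF sub] subspace_scale[OF sub])
  ultimately show ?case by blast
qed

end

section \<open>Indecomposability and two-dimensional odd parts\<close>

context quadratic_lie_superalgebra
begin

lemma br_even_alternating: "x \<in> L False \<Longrightarrow> y \<in> L False \<Longrightarrow> B (br x y) x = 0"
  using br_even_self[of x] br_even_swap[of x y False] B_invariant[of x x y]
  by (simp add: B_invariant[of x y x] B_simps)

lemma br_zero_by_parity:
  assumes "\<And>y. y \<in> L False \<Longrightarrow> br z y = 0" "\<And>y. y \<in> L True \<Longrightarrow> br z y = 0"
  shows "br z x = 0"
  using L_sum[of x] assms by (auto simp: br_simps)

text \<open>A set contained in the span of its own brackets stays inside every term of its derived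
  series.\<close>

lemma perfect_not_solvable:
  assumes "S \<subseteq> span {br x y |x y. x \<in> S \<and> y \<in> S}" and "x \<in> S" "x \<noteq> 0"
  shows "\<not> solvable smul br S"
proof -
  have "S \<subseteq> derived_series smul br S n" for n
  proof (induction n)
    case (Suc n)
    then have "{br x y |x y. x \<in> S \<and> y \<in> S} \<subseteq>
        {br x y |x y. x \<in> derived_series smul br S n \<and> y \<in> derived_series smul br S n}"
      by blast
    from span_mono[OF this] show ?case
      using assms(1) by simp
  qed simp
  then show ?thesis
    using assms(2,3) by (force simp: solvable_def)
qed

text \<open>Otherwise the line of \<open>z\<close> and its orthogonal complement are graded ideals
  with direct sum the whole algebra, and dimension above 1 keeps the complement nonzero. This is the
  main way in which indecomposability is used.\<close>

lemma even_part_central_isotropic: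
  assumes ind: "indecomposable smul L br B" and dim: "1 < dim (UNIV :: 'a set)"
    and z: "z \<in> L False" "\<And>x. br z x = 0"
  shows "B z z = 0"
proof (rule ccontr)
  assume nz: "B z z \<noteq> 0"
  have z': "br x z = 0" for x
  proof -
    obtain x0 x1 where "x0 \<in> L False" "x1 \<in> L True" "x = x0 + x1"
      using L_sum[of x] by blast
    then show ?thesis
      using br_even_swap[OF z(1), of x0 False] br_even_swap[OF z(1), of x1 True] z(2) by (simp add: br_simps)
  qed
  have "graded_ideal smul L br (span {z})"
    unfolding graded_ideal_def
  proof (intro conjI ballI allI)
    fix x assume "x \<in> span {z}"
    then obtain k where k: "x = smul k z"
      by (auto simp: span_singleton)
    then have "x \<in> span {z} \<inter> L False" "0 \<in> span {z} \<inter> L True" "x = x + 0"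
      using z(1) by (auto simp: span_zero subspace_0[OF subspace_L] intro: subspace_scale[OF subspace_L] span_scale span_base)
    then show "\<exists>x0\<in>span {z} \<inter> L False. \<exists>x1\<in>span {z} \<inter> L True. x = x0 + x1"
      by blast
    fix y show "br x y \<in> span {z}" "br y x \<in> span {z}"
      using k z(2) z' by (simp_all add: br_simps span_zero)
  qed simp
  moreover have "graded_ideal smul L br {x. B z x = 0}"
    unfolding graded_ideal_def
  proof (intro conjI ballI allI)
    show "subspace {x. B z x = 0}"
      by (auto simp: subspace_def B_simps)
    fix x assume x: "x \<in> {x. B z x = 0}"
    obtain x0 x1 where "x0 \<in> L False" "x1 \<in> L True" "x = x0 + x1"
      using L_sum[of x] by blast
    moreover from this have "B z x1 = 0" "B z x0 = 0"
      using x B_even[OF z(1)] by (auto simp: B_simps)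
    ultimately show "\<exists>x0\<in>{x. B z x = 0} \<inter> L False. \<exists>x1\<in>{x. B z x = 0} \<inter> L True. x = x0 + x1"
      by blast
    fix y
    \<comment> \<open>By invariance this is \<open>B (br z u) w\<close>, so every bracket lies in
      the complement of the central vector.\<close>
    have "B z (br u w) = 0" for u w
      using B_invariant[of z u w] z(2) by (simp add: B_simps)
    then show "br x y \<in> {x. B z x = 0}" "br y x \<in> {x. B z x = 0}"
      by auto
  qed
  moreover have "span {z} \<inter> {x. B z x = 0} = {0}"
    using nz by (auto simp: span_singleton B_simps image_iff intro!: exI[of _ 0])
  moreover have "\<exists>y\<in>span {z}. \<exists>w\<in>{x. B z x = 0}. x = y + w" for x
  proof (intro bexI)
    show "x = smul (B z x / B z z) z + (x - smul (B z x / B z z) z)" by simp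
  qed (use nz in \<open>auto simp: B_simps intro: span_scale span_base\<close>)
  moreover have "\<forall>x\<in>span {z}. \<forall>y\<in>{x. B z x = 0}. B x y = 0"
    by (auto simp: span_singleton B_simps)
  ultimately have "span {z} = {0} \<or> {x. B z x = 0} = {0}"
    using ind unfolding indecomposable_def by meson
  moreover have "span {z} \<noteq> {0}"
    using nz span_base[of z "{z}"] B_zero_left by force
  ultimately have J: "{x. B z x = 0} = {0}" by blast
  have "x \<in> span {z}" for x
  proof -
    have "x - smul (B z x / B z z) z \<in> {x. B z x = 0}"
      using nz by (simp add: B_simps)
    then show ?thesis
      unfolding J by (auto simp: span_singleton)
  qed
  then have "span {z} = UNIV" by blast
  then have "dim (UNIV :: 'a set) = dim {z}"
    using dim_span[of "{z}"] by simp
  moreover have "independent {z}"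
    using nz by (auto simp: B_simps)
  ultimately show False
    using dim dim_eq_card_independent[of "{z}"] by simp
qed

text \<open>If all odd brackets vanished, invariance would make the even part act trivially on the
  odd part, and the two parts would be orthogonal ideals.\<close>

lemma odd_part_bracket_nonzero:
  assumes ind: "indecomposable smul L br B" and "L False \<noteq> {0}" "L True \<noteq> {0}"
  shows "\<exists>x\<in>L True. \<exists>y\<in>L True. br x y \<noteq> 0"
proof (rule ccontr)
  assume "\<not> ?thesis"
  then have odd: "br x y = 0" if "x \<in> L True" "y \<in> L True" for x y
    using that by blast
  have even_odd: "br x y = 0" if x: "x \<in> L False" and y: "y \<in> L True" for x y
  proof (rule nondegenerateD[OF nondegenerate_L])
    show "br x y \<in> L True"
      using br_even[OF x y] .
    show "B (br x y) w = 0" if "w \<in> L True" for w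
      using odd[OF y that] by (simp add: B_invariant B_simps)
  qed
  have odd_even: "br y x = 0" if "x \<in> L False" "y \<in> L True" for x y
    using br_even_swap[OF that] even_odd[OF that] by simp
  have zero: "0 \<in> L p" for p
    by (rule subspace_0[OF subspace_L])
  have "graded_ideal smul L br (L p)" for p
    unfolding graded_ideal_def
  proof (intro conjI ballI allI)
    fix x assume x: "x \<in> L p"
    show "\<exists>x0\<in>L p \<inter> L False. \<exists>x1\<in>L p \<inter> L True. x = x0 + x1"
    proof (cases p)
      case True
      show ?thesis
        by (rule bexI[of _ 0], rule bexI[of _ x]) (use x True zero in auto)
    next
      case False
      show ?thesis
        by (rule bexI[of _ x], rule bexI[of _ 0]) (use x False zero in auto)
    qed
    fix y
    obtain y0 y1 where "y0 \<in> L False" "y1 \<in> L True" "y = y0 + y1"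
      using L_sum[of y] by blast
    then show "br x y \<in> L p" "br y x \<in> L p"
      using x odd even_odd odd_even br_even[of x y0 False] br_even[of y0 x False]
      by (cases p; simp add: br_simps zero)+
  qed (rule subspace_L)
  moreover have "\<forall>x. \<exists>y\<in>L False. \<exists>z\<in>L True. x = y + z"
    using L_sum by blast
  moreover have "\<forall>x\<in>L False. \<forall>y\<in>L True. B x y = 0"
    using B_even by blast
  ultimately show False
    using ind assms(2,3) L_inter unfolding indecomposable_def by blast
qed

text \<open>The Jacobi identity for three equal odd vectors says that three times this element is
  zero.\<close>

lemma br_odd_cube:
  assumes y: "y \<in> L True"
  shows "br (br y y) y = 0"
proof -
  have "br y (br y y) = br (br y y) y - br y (br y y)"
    using br_jacobi[OF y y y] by (simp add: koszul_def)
  then have "- br (br y y) y = br (br y y) y + br (br y y) y"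
    using br_even_swap[OF br_odd[OF y y] y] by simp
  then have "br (br y y) y + (br (br y y) y + br (br y y) y) = 0"
    by (metis add.right_inverse)
  moreover have "smul (1 + (1 + 1)) (br (br y y) y) = br (br y y) y + (br (br y y) y + br (br y y) y)"
    by (simp only: scale_left_distrib scale_one)
  ultimately show ?thesis by simp
qed

text \<open>On a symplectic plane, invariance and the Jacobi identities of \<open>e\<close>, \<open>f\<close> leave one scalar.\<close>

lemma odd_plane_brackets:
  assumes e: "e \<in> L True" and f: "f \<in> L True" and ef: "B e f = 1"
    and plane: "\<And>y. y \<in> L True \<Longrightarrow> y = smul (B y f) e - smul (B y e) f"
  obtains \<alpha> where "br (br e e) e = 0" "br (br e e) f = smul \<alpha> e"
    "br (br e f) e = smul (- \<alpha> / 2) e" "br (br e f) f = smul (\<alpha> / 2) f"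
    "br (br f f) e = smul (- \<alpha>) f" "br (br f f) f = 0"
proof -
  define E F H where "E = br e e" and "F = br f f" and "H = br e f"
  have even: "E \<in> L False" "F \<in> L False" "H \<in> L False"
    using e f by (auto simp: E_def F_def H_def br_odd)
  \<comment> \<open>The Jacobi identity with \<open>y\<close> repeated ties the actions of
    \<open>E\<close> and \<open>F\<close> to that of \<open>H\<close>.\<close>
  have polar: "br (br y y) w = - smul 2 (br (br y w) y)" if y: "y \<in> L True" and w: "w \<in> L True" for y w
  proof -
    have "br (br y y) w = br y (br y w) + br y (br y w)"
      using br_jacobi[OF y y w] by (simp add: koszul_def eq_diff_eq)
    moreover have "br y (br y w) = - br (br y w) y"
      using br_even_swap[OF br_odd[OF y w] y] .
    ultimately have "br (br y y) w = - (br (br y w) y + br (br y w) y)"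
      by simp
    moreover have "smul (1 + 1) (br (br y w) y) = br (br y w) y + br (br y w) y"
      by (simp only: scale_left_distrib scale_one)
    ultimately show ?thesis by simp
  qed
  have odd: "br X y \<in> L True" if "X \<in> L False" "y \<in> L True" for X y
    using br_even that by blast
  define \<alpha> where "\<alpha> = B (br E f) f"
  have fe_H: "br f e = H"
    using br_odd_swap[OF e f] by (simp add: H_def)
  have "B (br E f) e = B E H"
    by (simp add: B_invariant fe_H)
  also have "\<dots> = B (br E e) f"
    by (simp add: H_def B_invariant)
  also have "\<dots> = 0"
    using br_odd_cube[OF e] by (simp add: E_def B_simps)
  finally have Ef: "br E f = smul \<alpha> e"
    using plane[OF odd[OF even(1) f]] by (simp add: \<alpha>_def)
  have He: "br H e = smul (- \<alpha> / 2) e"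
  proof -
    have "smul (-1/2) (br E f) = br H e"
      using polar[OF e f] by (simp add: E_def H_def)
    then show ?thesis
      by (simp add: Ef)
  qed
  \<comment> \<open>Both \<open>B (br H f) e\<close> and \<open>B (br H e) f\<close> reduce to
    \<open>B H H\<close> by invariance, so the known action on \<open>e\<close> determines one
    coordinate of \<open>br H f\<close>.\<close>
  have "B (br H f) e = B H H"
    by (simp add: B_invariant fe_H)
  also have "\<dots> = B (br H e) f"
    by (simp add: B_invariant H_def)
  finally have "B (br H f) e = - \<alpha> / 2"
    by (simp add: He B_simps ef)
  \<comment> \<open>The other coordinate is zero: by invariance and symmetry it equals
    \<open>B F H\<close>, hence \<open>B (br F f) e\<close>, and \<open>br F f\<close> is a
    cube.\<close>
  moreover have "B (br H f) f = B (br F e) f"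
    using B_even_sym[OF even(3,2)] by (simp add: B_invariant F_def[symmetric] H_def[symmetric])
  moreover have "B (br F e) f = B (br F f) e"
    by (simp add: B_invariant fe_H H_def[symmetric])
  moreover have "br F f = 0"
    using br_odd_cube[OF f] by (simp add: F_def)
  ultimately have Hf: "br H f = smul (\<alpha> / 2) f"
    using plane[OF odd[OF even(3) f]] by (simp add: B_simps)
  have "br F e = smul (- \<alpha>) f"
    using polar[OF f e] by (simp add: F_def[symmetric] fe_H Hf)
  with Ef He Hf br_odd_cube[OF e] br_odd_cube[OF f] show thesis
    by (intro that[of \<alpha>]) (simp_all add: E_def F_def H_def)
qed

text \<open>Invariance moves one factor of the second bracket to the left, so each entry is read off
  from the action on \<open>e\<close> and \<open>f\<close>. All entries are multiples of
  \<open>\<alpha>\<close>: the three vectors are mutually orthogonal and isotropic exactly when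
  \<open>\<alpha>\<close> is zero.\<close>

lemma odd_plane_gram:
  assumes e: "e \<in> L True" and f: "f \<in> L True" and ef: "B e f = 1"
    and rel: "br (br e e) e = 0" "br (br e e) f = smul \<alpha> e"
    "br (br e f) e = smul (- \<alpha> / 2) e" "br (br e f) f = smul (\<alpha> / 2) f"
    "br (br f f) e = smul (- \<alpha>) f" "br (br f f) f = 0"
  shows "B (br e e) (br e e) = 0" "B (br e e) (br f f) = \<alpha>" "B (br e e) (br e f) = 0"
    "B (br f f) (br f f) = 0" "B (br e f) (br f f) = 0" "B (br e f) (br e f) = - \<alpha> / 2"
  using B_invariant[of "br e e" e e] B_invariant[of "br e e" f f] B_invariant[of "br e e" e f]
    B_invariant[of "br f f" f f] B_invariant[of "br e f" f f] B_invariant[of "br e f" e f]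
  by (simp_all add: rel B_simps ef B_odd_self[OF e] B_odd_self[OF f])

end

section \<open>Parity of the odd dimension, exclusion of \<open>(1|4)\<close>, and the degenerate
  \<open>(3|2)\<close> case\<close>

context finite_quadratic_lie_superalgebra
begin

text \<open>Odd vectors are isotropic, so any nonzero \<open>u\<close> and a partner
  \<open>v\<close> form a hyperbolic plane; splitting it off lowers the dimension by two.\<close>

lemma even_dim_symplectic:
  assumes "nondegenerate U" and "U \<subseteq> L True"
  shows "even (dim U)"
  using assms
proof (induction "dim U" arbitrary: U rule: less_induct)
  case less
  note sub = nondegenerate_subspace[OF less.prems(1)]
  have odd: "x \<in> L True" if "x \<in> U" for x
    using that less.prems(2) by blast
  show ?case
  proof (cases "U = {0}")
    case False
    then obtain u where u: "u \<in> U" "u \<noteq> 0"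
      using subspace_0[OF sub] by blast
    obtain v where v: "v \<in> U" "B u v = 1"
      using exists_paired[OF less.prems(1) u] by blast
    let ?U = "{x\<in>U. B x u = 0 \<and> B x v = 0}"
    have "B y x = (-1) * B x y" if "x \<in> U" "y \<in> U" for x y
      using B_odd_skew[OF odd[OF that(1)] odd[OF that(2)]] by simp
    note split = split_hyperbolic[OF less.prems(1) this _ u(1) B_odd_self[OF odd[OF u(1)]]
        v(1) B_odd_self[OF odd[OF v(1)]] v(2)]
    have "nondegenerate ?U" "dim U = Suc (Suc (dim ?U))"
      using split by simp_all
    moreover have "?U \<subseteq> L True"
      using less.prems(2) by blast
    ultimately show ?thesis
      using less.hyps[of ?U] by simp
  next
    case True
    then have "dim U = 0" by simp
    then show ?thesis by presburger
  qed
qed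

text \<open>A unit vector \<open>z\<close> spans the even part. Once it is shown to act trivially on
  the odd part, it is central and not isotropic.\<close>

lemma even_line_contradiction:
  assumes ind: "indecomposable smul L br B" and dim: "1 < dim (UNIV :: 'a set)"
    and one: "dim (L False) = 1"
  shows False
proof -
  have ne: "L False \<noteq> {0}"
    using dim_zero_eq[OF subspace_L, of False] one by linarith
  have sym: "B y x = B x y" if "x \<in> L False" "y \<in> L False" for x y
    using B_even_sym that by blast
  obtain z where z: "z \<in> L False" "B z z = 1"
    using exists_unit[OF nondegenerate_L ne sym] by blast
  have "dim {x \<in> L False. B x z = 0} = 0" "nondegenerate {x \<in> L False. B x z = 0}"
    using split_unit[OF nondegenerate_L sym z] one by simp_all
  then have orth: "{x \<in> L False. B x z = 0} = {0}"
    using dim_zero_eq[OF nondegenerate_subspace] by blast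
  have line: "x = smul (B x z) z" if x: "x \<in> L False" for x
  proof -
    have "x - smul (B x z) z \<in> {x \<in> L False. B x z = 0}"
      using x z by (simp add: B_simps subspace_diff[OF subspace_L] subspace_scale[OF subspace_L])
    then show ?thesis
      unfolding orth by simp
  qed
  have odd: "br z y = 0" if y: "y \<in> L True" for y
  proof (rule ccontr)
    assume nz: "br z y \<noteq> 0"
    have zy: "br z y \<in> L True"
      using br_even[OF z(1) y] .
    have nz': "br y z \<noteq> 0"
      using nz br_even_swap[OF z(1) y] by simp
    \<comment> \<open>Odd brackets are multiples of \<open>z\<close>, so a vanishing double bracket
      forces the coefficient to vanish while \<open>br y z\<close> is nonzero. This is applied to
      \<open>w = y\<close> through the cube identity, then to all \<open>w\<close>.\<close>
    have scalar: "br y (br y w) = smul (B (br y w) z) (br y z)" if "w \<in> L True" for w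
      using line[OF br_odd[OF y that]] by (metis br_scale_right)
    have "br y (br y y) = 0"
      using br_even_swap[OF br_odd[OF y y] y] br_odd_cube[OF y] by simp
    then have "B (br y y) z = 0"
      using scalar[OF y] nz' by simp
    then have yy: "br y y = 0"
      using line[OF br_odd[OF y y]] by simp
    have "B (br z y) w = 0" if w: "w \<in> L True" for w
    proof -
      have "br y (br y w) = - br y (br y w)"
        using br_jacobi[OF y y w] yy by (simp add: koszul_def br_simps)
      then have "smul (1 + 1) (br y (br y w)) = 0"
        by (simp only: scale_left_distrib scale_one eq_neg_iff_add_eq_0)
      then have "B (br y w) z = 0"
        using scalar[OF w] nz' by simp
      then show ?thesis
        using B_even_sym[OF z(1) br_odd[OF y w]] by (simp add: B_invariant)
    qed
    then show False
      using nondegenerateD[OF nondegenerate_L zy] nz by blast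
  qed
  have even: "br z y = 0" if "y \<in> L False" for y
  proof -
    have "br z (smul (B y z) z) = 0"
      by (simp add: br_simps br_even_self[OF z(1)])
    then show ?thesis
      using line[OF that] by simp
  qed
  show False
    using even_part_central_isotropic[OF ind dim z(1)] br_zero_by_parity[OF even odd] z(2) by simp
qed

text \<open>Splitting off the plane of \<open>u\<close> and \<open>v\<close> leaves a nondegenerate
  line. The coefficients are crossed because \<open>u\<close> and \<open>v\<close> are dual to each
  other.\<close>

lemma witt_three:
  assumes U: "nondegenerate U" and sym: "\<And>x y. x \<in> U \<Longrightarrow> y \<in> U \<Longrightarrow> B y x = B x y"
    and dim: "dim U = 3" and uv: "u \<in> U" "B u u = 0" "v \<in> U" "B v v = 0" "B u v = 1"
  obtains t where "t \<in> U" "B t u = 0" "B t v = 0" "B t t = 1"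
    "\<And>x. x \<in> U \<Longrightarrow> x = smul (B x v) u + smul (B x u) v + smul (B x t) t"
proof -
  let ?U = "{x\<in>U. B x u = 0 \<and> B x v = 0}"
  note sub = nondegenerate_subspace[OF U]
  have sym': "B y x = 1 * B x y" if "x \<in> U" "y \<in> U" for x y
    using sym[OF that] by simp
  have U': "nondegenerate ?U" "dim U = Suc (Suc (dim ?U))"
    using split_hyperbolic[OF U sym' _ uv] by simp_all
  have "?U \<noteq> {0}"
    by (rule nonzero_of_dim) (use U'(2) dim in linarith)
  then obtain t where t: "t \<in> ?U" "B t t = 1"
    using exists_unit[OF U'(1)] sym by auto
  have sym2: "B y x = B x y" if "x \<in> ?U" "y \<in> ?U" for x y
    using sym that by auto
  have "nondegenerate {x\<in>?U. B x t = 0}" "dim {x\<in>?U. B x t = 0} = 0"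
    using split_unit[OF U'(1) sym2 t] U'(2) dim by simp_all
  then have orth: "{x\<in>?U. B x t = 0} = {0}"
    using dim_zero_eq[OF nondegenerate_subspace] by blast
  have "x = smul (B x v) u + smul (B x u) v + smul (B x t) t" if x: "x \<in> U" for x
  proof -
    have "B v u = 1" "B u t = 0" "B v t = 0"
      using sym[of u v] sym[of t u] sym[of t v] uv t by auto
    then have "x - (smul (B x v) u + smul (B x u) v + smul (B x t) t) \<in> {x\<in>?U. B x t = 0}"
      using x uv t by (simp add: B_simps subspace_diff[OF sub] subspace_add[OF sub] subspace_scale[OF sub])
    then show ?thesis
      unfolding orth by simp
  qed
  with t show thesis
    by (intro that[of t]) auto
qed

lemma odd_plane_basis:
  assumes dim: "dim (L True) = 2"
  obtains e f where "e \<in> L True" "f \<in> L True" "B e f = 1"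
    "\<And>y. y \<in> L True \<Longrightarrow> y = smul (B y f) e - smul (B y e) f"
proof -
  have "L True \<noteq> {0}"
    by (rule nonzero_of_dim) (use dim in linarith)
  then obtain e where e: "e \<in> L True" "e \<noteq> 0"
    using subspace_0[OF subspace_L] by blast
  obtain f where f: "f \<in> L True" "B e f = 1"
    using exists_paired[OF nondegenerate_L e] by blast
  have skew: "B y x = (-1) * B x y" if "x \<in> L True" "y \<in> L True" for x y
    using B_odd_skew[OF that] by simp
  let ?U = "{x \<in> L True. B x e = 0 \<and> B x f = 0}"
  have "nondegenerate ?U" "dim ?U = 0"
    using split_hyperbolic[OF nondegenerate_L skew _ e(1) B_odd_self[OF e(1)] f(1) B_odd_self[OF f(1)] f(2)] dim
    by simp_all
  then have orth: "?U = {0}"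
    using dim_zero_eq[OF nondegenerate_subspace] by blast
  have "y = smul (B y f) e - smul (B y e) f" if y: "y \<in> L True" for y
  proof -
    have "y - (smul (B y f) e - smul (B y e) f) \<in> ?U"
      using y e f skew[OF e(1) f(1)]
      by (simp add: B_simps B_odd_self subspace_diff[OF subspace_L] subspace_scale[OF subspace_L])
    then show ?thesis
      unfolding orth by simp
  qed
  with e f show thesis
    using that[of e f] by blast
qed

text \<open>With \<open>\<alpha> = 0\<close> the set \<open>W\<close> of brackets is isotropic and
  kills the odd part. A nonzero \<open>w\<close> in \<open>W\<close> extends to a Witt basis
  \<open>w\<close>, \<open>v\<close>, \<open>t\<close> of the even part, whose brackets depend on
  one constant \<open>c\<close>. Either value of \<open>c\<close>, zero or not, contradicts
  indecomposability.\<close>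

lemma odd_plane_scalar_nonzero:
  assumes ind: "indecomposable smul L br B" and dim: "dim (L False) = 3" "dim (L True) = 2"
    and e: "e \<in> L True" and f: "f \<in> L True" and ef: "B e f = 1"
    and plane: "\<And>y. y \<in> L True \<Longrightarrow> y = smul (B y f) e - smul (B y e) f"
    and rel: "br (br e e) e = 0" "br (br e e) f = smul \<alpha> e"
    "br (br e f) e = smul (- \<alpha> / 2) e" "br (br e f) f = smul (\<alpha> / 2) f"
    "br (br f f) e = smul (- \<alpha>) f" "br (br f f) f = 0"
  shows "\<alpha> \<noteq> 0"
proof
  assume \<alpha>: "\<alpha> = 0"
  define W where "W = {br e e, br f f, br e f}"
  have W_even: "w \<in> L False" if "w \<in> W" for w
    using that e f by (auto simp: W_def br_odd)
  have sym: "B y x = B x y" if "x \<in> L False" "y \<in> L False" for x y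
    using B_even_sym that by blast
  have fe: "br f e = br e f"
    using br_odd_swap[OF e f] .
  have W_isotropic: "B w w' = 0" if "w \<in> W" "w' \<in> W" for w w'
    using that odd_plane_gram[OF e f ef rel] \<alpha> sym[of "br e e" "br f f"] sym[of "br e e" "br e f"]
      sym[of "br f f" "br e f"] W_even by (auto simp: W_def)
  have plane': "\<exists>a b. y = smul a e + smul b f" if "y \<in> L True" for y
  proof -
    have "y = smul (B y f) e + smul (- B y e) f"
      using plane[OF that] by simp
    then show ?thesis by blast
  qed
  have W_odd: "br w y = 0" if "w \<in> W" "y \<in> L True" for w y
    using that(1) plane'[OF that(2)] rel \<alpha> by (auto simp: W_def br_simps)
  have B_br_odd: "B t (br y y') = 0" if t: "\<And>w. w \<in> W \<Longrightarrow> B t w = 0" and "y \<in> L True" "y' \<in> L True" for t y y'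
    using plane'[OF that(2)] plane'[OF that(3)] t[of "br e e"] t[of "br e f"] t[of "br f f"] fe
    by (auto simp: W_def br_simps B_simps)
  have ne: "L p \<noteq> {0}" for p
  proof
    assume "L p = {0}"
    then have "dim (L p) = 0" by simp
    then show False using dim by (cases p) simp_all
  qed
  have "\<exists>w\<in>W. w \<noteq> 0"
  proof (rule ccontr)
    assume "\<not> (\<exists>w\<in>W. w \<noteq> 0)"
    then have "br e e = 0" "br e f = 0" "br f f = 0"
      by (auto simp: W_def)
    then have "br y y' = 0" if "y \<in> L True" "y' \<in> L True" for y y'
      using plane'[OF that(1)] plane'[OF that(2)] fe by (auto simp: br_simps)
    then show False
      using odd_part_bracket_nonzero[OF ind ne ne] by blast
  qed
  then obtain w where w: "w \<in> W" "w \<noteq> 0" by blast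
  have w': "w \<in> L False" "B w w = 0"
    using W_even W_isotropic w by blast+
  obtain v where v: "v \<in> L False" "B w v = 1" "B v v = 0"
    using exists_hyperbolic[OF nondegenerate_L sym w'(1) w(2) w'(2)] by blast
  obtain t where t: "t \<in> L False" "B t w = 0" "B t v = 0" "B t t = 1"
    and span: "\<And>x. x \<in> L False \<Longrightarrow> x = smul (B x v) w + smul (B x w) v + smul (B x t) t"
    using witt_three[OF nondegenerate_L sym dim(1) w' v(1,3,2)] by blast
  define c where "c = B (br w t) v"
  have even: "br x y \<in> L False" if "x \<in> L False" "y \<in> L False" for x y
    using br_even that by blast
  note alt = br_even_alternating
  have vt_w: "B (br v t) w = - c"
    using B_invariant[of v t w] sym[OF even[OF w'(1) t(1)] v(1)] br_even_swap[OF w'(1) t(1)]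
    by (simp add: c_def B_simps)
  have vw_t: "B (br v w) t = c"
    using B_invariant[of v w t] sym[OF even[OF w'(1) t(1)] v(1)] by (simp add: c_def)
  have alt_right: "B (br x y) y = 0" if "x \<in> L False" "y \<in> L False" for x y
    using B_invariant[of x y y] br_even_self[OF that(2)] by (simp add: B_simps)
  have vw: "br v w = smul c t"
    using span[OF even[OF v(1) w'(1)]] alt[OF v(1) w'(1)] alt_right[OF v(1) w'(1)] vw_t by simp
  have vt: "br v t = smul (- c) v"
    using span[OF even[OF v(1) t(1)]] alt[OF v(1) t(1)] alt_right[OF v(1) t(1)] vt_w by simp
  have wt: "br w t = smul c w"
    using span[OF even[OF w'(1) t(1)]] alt[OF w'(1) t(1)] alt_right[OF w'(1) t(1)] by (simp add: c_def)
  show False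
  proof (cases "c = 0")
    case True
    \<comment> \<open>Expanding \<open>B x x = 0\<close> in the Witt basis with
      \<open>B x w = 0\<close> leaves only the square of \<open>B x t\<close>. So \<open>t\<close>
      is orthogonal to all odd brackets, which makes it central.\<close>
    have W_t: "B t x = 0" if x: "x \<in> W" for x
    proof -
      have xw: "B x w = 0" and xx: "B x x = 0" and xt: "B t x = B x t"
        using W_isotropic[OF x] w(1) x sym[OF W_even[OF x] t(1)] by blast+
      have "B x x = B x v * B x w + B x w * B x v + B x t * B x t"
        using arg_cong[OF span[OF W_even[OF x]], of "B x"] by (simp only: B_simps)
      then show ?thesis
        unfolding xw xx xt by simp
    qed
    have t_odd: "br t y = 0" if y: "y \<in> L True" for y
    proof (rule nondegenerateD[OF nondegenerate_L br_even[OF t(1) y]])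
      fix y' assume "y' \<in> L True"
      then show "B (br t y) y' = 0"
        using B_br_odd[OF W_t y] by (simp add: B_invariant)
    qed
    have t_even: "br t x = 0" if x: "x \<in> L False" for x
    proof -
      have "br t w = 0" "br t v = 0" "br t t = 0"
        using br_even_swap[OF w'(1) t(1)] br_even_swap[OF v(1) t(1)] br_even_self[OF t(1)] wt vt True by simp_all
      then have "br t (smul (B x v) w + smul (B x w) v + smul (B x t) t) = 0"
        by (simp add: br_simps)
      then show ?thesis
        using span[OF x] by simp
    qed
    have "1 < dim (UNIV :: 'a set)"
      using dim_L dim by simp
    then show False
      using even_part_central_isotropic[OF ind _ t(1) br_zero_by_parity[OF t_even t_odd]] t(4) by simp
  next
    case False
    \<comment> \<open>The even part acts on the odd part by commutators. As \<open>w\<close> acts by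
      zero, so does \<open>t\<close> because \<open>br v w = smul c t\<close>, and then
      \<open>v\<close> because \<open>br v t = smul (- c) v\<close>.\<close>
    have comm: "br (br x x') y = br x (br x' y) - br x' (br x y)"
      if "x \<in> L False" "x' \<in> L False" "y \<in> L True" for x x' y
      using br_jacobi[OF that] by (simp add: koszul_def)
    have w_odd: "br w y = 0" if "y \<in> L True" for y
      using W_odd[OF w(1) that] .
    have t_odd: "br t y = 0" if y: "y \<in> L True" for y
      using comm[OF v(1) w'(1) y] w_odd[OF y] w_odd[OF br_even[OF v(1) y]] False by (simp add: vw br_simps)
    have v_odd: "br v y = 0" if y: "y \<in> L True" for y
      using comm[OF v(1) t(1) y] t_odd[OF y] t_odd[OF br_even[OF v(1) y]] False by (simp add: vt br_simps)
    have even_odd: "br x y = 0" if x: "x \<in> L False" and y: "y \<in> L True" for x y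
    proof -
      have "br (smul (B x v) w + smul (B x w) v + smul (B x t) t) y = 0"
        by (simp add: br_simps w_odd[OF y] t_odd[OF y] v_odd[OF y])
      then show ?thesis
        using span[OF x] by simp
    qed
    \<comment> \<open>Invariance turns the pairing with an even \<open>x\<close> into one with
      \<open>br y' x\<close>, which is zero.\<close>
    have "br y y' = 0" if y: "y \<in> L True" and y': "y' \<in> L True" for y y'
    proof (rule nondegenerateD[OF nondegenerate_L br_odd[OF y y']])
      fix x assume "x \<in> L False"
      then show "B (br y y') x = 0"
        using even_odd[OF _ y'] br_even_swap[OF _ y', of x] by (simp add: B_invariant B_simps)
    qed
    then show False
      using odd_part_bracket_nonzero[OF ind ne ne] by blast
  qed
qed

end

section \<open>Recognising \<open>osp(1,2)\<close>\<close>

text \<open>The arguments are the free entries left by \<open>osp12_mats_iff\<close>: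
  \<open>d\<close> and \<open>g\<close> are odd, while \<open>h\<close>, \<open>m\<close>,
  \<open>n\<close> fill the trace-free even block.\<close>

definition osp12_of_entries :: "complex \<Rightarrow> complex \<Rightarrow> complex \<Rightarrow> complex \<Rightarrow> complex \<Rightarrow> osp12" where
  "osp12_of_entries d g h m n = Abs_osp12 (vector [vector [0, g, - d], vector [d, h, m], vector [g, n, - h]])"

lemma Rep_osp12_of_entries:
  "Rep_osp12 (osp12_of_entries d g h m n) = vector [vector [0, g, - d], vector [d, h, m], vector [g, n, - h]]"
  unfolding osp12_of_entries_def by (rule Abs_osp12_inverse) (simp add: osp12_mats_iff)

lemma osp12_entries_eq:
  "Rep_osp12 M $ 1 $ 1 = 0" "Rep_osp12 M $ 3 $ 3 = - Rep_osp12 M $ 2 $ 2"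
  "Rep_osp12 M $ 1 $ 2 = Rep_osp12 M $ 3 $ 1" "Rep_osp12 M $ 1 $ 3 = - Rep_osp12 M $ 2 $ 1"
  using Rep_osp12[of M] by (auto simp: osp12_mats_iff)

context quadratic_lie_superalgebra
begin

text \<open>An even vector acts as a derivation on the bracket of two odd vectors, so its action on
  \<open>e\<close> and \<open>f\<close> determines these brackets.\<close>

lemma odd_plane_even_brackets:
  assumes e: "e \<in> L True" and f: "f \<in> L True"
    and rel: "br (br e e) e = 0" "br (br e e) f = smul \<alpha> e"
    "br (br e f) e = smul (- \<alpha> / 2) e" "br (br e f) f = smul (\<alpha> / 2) f"
    "br (br f f) e = smul (- \<alpha>) f" "br (br f f) f = 0"
  shows "br (br e e) (br f f) = smul (2 * \<alpha>) (br e f)" "br (br e f) (br e e) = smul (- \<alpha>) (br e e)"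
    "br (br e f) (br f f) = smul \<alpha> (br f f)"
proof -
  have comm: "br X (br y z) = br (br X y) z + br y (br X z)" if "X \<in> L False" "y \<in> L True" "z \<in> L True" for X y z
    using br_jacobi[OF that] by (simp add: koszul_def)
  have double: "smul c x + smul c x = smul (2 * c) x" for c x
    by (simp flip: scale_left_distrib)
  note fe = br_odd_swap[OF e f]
  show "br (br e e) (br f f) = smul (2 * \<alpha>) (br e f)"
    using comm[OF br_odd[OF e e] f f] double[of \<alpha> "br e f"] by (simp add: rel fe br_simps)
  show "br (br e f) (br e e) = smul (- \<alpha>) (br e e)"
    using comm[OF br_odd[OF e f] e e] double[of "- \<alpha> / 2" "br e e"] by (simp add: rel br_simps)
  show "br (br e f) (br f f) = smul \<alpha> (br f f)"
    using comm[OF br_odd[OF e f] f f] double[of "\<alpha> / 2" "br f f"] by (simp add: rel br_simps)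
qed

text \<open>With the scalar normalised to -2, the relations on \<open>e\<close> and \<open>f\<close>
  determine all brackets, and they agree with the supercommutators of matrices.\<close>

lemma isomorphic_osp12:
  assumes e: "e \<in> L True" and f: "f \<in> L True"
    and rel: "br (br e e) e = 0" "br (br e e) f = smul (-2) e"
    "br (br e f) e = e" "br (br e f) f = - f" "br (br f f) e = smul 2 f" "br (br f f) f = 0"
    and odd: "\<And>y. y \<in> L True \<Longrightarrow> \<exists>a b. y = smul a e + smul b f"
    and even: "\<And>x. x \<in> L False \<Longrightarrow> \<exists>a b c. x = smul a (br e f) + smul b (br e e) + smul c (br f f)"
    and indep_odd: "\<And>a b. smul a e + smul b f = 0 \<Longrightarrow> a = 0 \<and> b = 0"
    and indep_even: "\<And>a b c. smul a (br e f) + smul b (br e e) + smul c (br f f) = 0 \<Longrightarrow> a = 0 \<and> b = 0 \<and> c = 0"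
  shows "isomorphic smul L br osp12_scale osp12_part osp12_bracket"
proof -
  define E F H where "E = br e e" and "F = br f f" and "H = br e f"
  note rel' = rel[folded E_def F_def H_def]
  have ev: "E \<in> L False" "F \<in> L False" "H \<in> L False"
    using e f by (auto simp: E_def F_def H_def br_odd)
  have swap: "br e E = 0" "br f E = smul 2 e" "br e H = - e" "br f H = f" "br e F = smul (-2) f" "br f F = 0"
    using br_even_swap[OF ev(1) e] br_even_swap[OF ev(1) f] br_even_swap[OF ev(2) e] br_even_swap[OF ev(2) f]
      br_even_swap[OF ev(3) e] br_even_swap[OF ev(3) f] rel' by simp_all
  have odd_odd: "br e e = E" "br e f = H" "br f e = H" "br f f = F"
    using br_odd_swap[OF e f] by (simp_all add: E_def F_def H_def)
  have EF: "br E F = smul (-4) H" and HE: "br H E = smul 2 E" and HF: "br H F = smul (-2) F"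
    using odd_plane_even_brackets[OF e f, of "-2"] rel by (simp_all add: E_def F_def H_def)
  have even_even: "br E E = 0" "br F F = 0" "br H H = 0" "br F E = smul 4 H" "br E H = smul (-2) E" "br F H = smul 2 F"
    using br_even_self[OF ev(1)] br_even_self[OF ev(2)] br_even_self[OF ev(3)]
      br_even_swap[OF ev(1,2)] br_even_swap[OF ev(3,1)] br_even_swap[OF ev(3,2)] EF HE HF by simp_all
  define odd_comb where "odd_comb d g = smul d e + smul g f" for d g
  define even_comb where "even_comb h m n = smul h H + smul m E + smul n F" for h m n
  \<comment> \<open>The odd generators are the matrices with \<open>d = 1\<close> or
    \<open>g = 1\<close> only. Their squares under the supercommutator have the single entry -2 at
    \<open>(2,3)\<close> and 2 at \<open>(3,2)\<close>, whence the factors -1/2 and 1/2; their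
    mutual bracket is the diagonal matrix with entries 0, 1, -1.\<close>
  define \<phi> where "\<phi> M = (let A = Rep_osp12 M in
    odd_comb (A$2$1) (A$3$1) + even_comb (A$2$2) (- (A$2$3) / 2) (A$3$2 / 2))" for M
  have odd_comb: "odd_comb d g \<in> L True" and even_comb: "even_comb h m n \<in> L False" for d g h m n
    using e f ev by (simp_all add: odd_comb_def even_comb_def subspace_add[OF subspace_L] subspace_scale[OF subspace_L])
  have comb_0: "odd_comb 0 0 = 0" "even_comb 0 0 0 = 0"
    by (simp_all add: odd_comb_def even_comb_def)
  have br_odd_odd: "br (odd_comb d g) (odd_comb d' g') = even_comb (d * g' + g * d') (d * d') (g * g')" for d g d' g'
    by (simp add: odd_comb_def even_comb_def br_simps odd_odd algebra_simps)
  have br_even_odd: "br (even_comb h m n) (odd_comb d g) = odd_comb (h * d - 2 * (m * g)) (2 * (n * d) - h * g)" for h m n d g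
    by (simp add: odd_comb_def even_comb_def br_simps rel' algebra_simps)
  have br_odd_even: "br (odd_comb d g) (even_comb h m n) = odd_comb (2 * (m * g) - h * d) (h * g - 2 * (n * d))" for h m n d g
    by (simp add: odd_comb_def even_comb_def br_simps swap algebra_simps)
  have br_even_even: "br (even_comb h m n) (even_comb h' m' n') =
      even_comb (4 * (n * m' - m * n')) (2 * (h * m' - m * h')) (2 * (n * h' - h * n'))" for h m n h' m' n'
    by (simp add: even_comb_def br_simps even_even EF HE HF algebra_simps)
  have add_odd: "odd_comb d g + odd_comb d' g' = odd_comb (d + d') (g + g')" for d g d' g'
    by (simp add: odd_comb_def algebra_simps)
  have add_even: "even_comb h m n + even_comb h' m' n' = even_comb (h + h') (m + m') (n + n')" for h m n h' m' n'
    by (simp add: even_comb_def algebra_simps)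
  have scale_odd: "smul c (odd_comb d g) = odd_comb (c * d) (c * g)" for c d g
    by (simp add: odd_comb_def algebra_simps)
  have scale_even: "smul c (even_comb h m n) = even_comb (c * h) (c * m) (c * n)" for c h m n
    by (simp add: even_comb_def algebra_simps)
  note reps = plus_osp12.rep_eq osp12_scale.rep_eq osp12_bracket.rep_eq
  have add: "\<phi> (M + N) = \<phi> M + \<phi> N" for M N
  proof -
    have "odd_comb d g + even_comb h m n + (odd_comb d' g' + even_comb h' m' n') =
        odd_comb (d + d') (g + g') + even_comb (h + h') (m + m') (n + n')" for d g h m n d' g' h' m' n'
      by (simp add: ac_simps flip: add_odd add_even)
    then show ?thesis
      by (simp add: \<phi>_def Let_def reps add_divide_distrib)
  qed
  have scale: "\<phi> (osp12_scale c M) = smul c (\<phi> M)" for c M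
    by (simp add: \<phi>_def Let_def reps mat_scale_def scale_right_distrib scale_odd scale_even)
  have bracket: "\<phi> (osp12_bracket M N) = br (\<phi> M) (\<phi> N)" for M N
  proof -
    have "br (odd_comb d g + even_comb h m n) (odd_comb d' g' + even_comb h' m' n') =
        odd_comb (2 * (m' * g) - h' * d + (h * d' - 2 * (m * g'))) (h' * g - 2 * (n' * d) + (2 * (n * d') - h * g'))
        + even_comb (d * g' + g * d' + 4 * (n * m' - m * n')) (d * d' + 2 * (h * m' - m * h')) (g * g' + 2 * (n * h' - h * n'))"
      (is "?l = ?r") for d g h m n d' g' h' m' n'
    proof -
      have "?l = br (odd_comb d g) (odd_comb d' g') + br (odd_comb d g) (even_comb h' m' n')
          + (br (even_comb h m n) (odd_comb d' g') + br (even_comb h m n) (even_comb h' m' n'))"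
        by (simp only: br_add_left br_add_right ac_simps)
      also have "\<dots> = (br (odd_comb d g) (even_comb h' m' n') + br (even_comb h m n) (odd_comb d' g'))
          + (br (odd_comb d g) (odd_comb d' g') + br (even_comb h m n) (even_comb h' m' n'))"
        by (simp only: ac_simps)
      also have "\<dots> = ?r"
        by (simp only: br_odd_odd br_even_odd br_odd_even br_even_even add_odd add_even)
      finally show ?thesis .
    qed
    then show ?thesis
      by (simp add: \<phi>_def Let_def reps supercommutator_nth sum_3 coord_parity_def koszul_def osp12_entries_eq
          algebra_simps diff_divide_distrib add_divide_distrib)
  qed
  have surj: "\<phi> (osp12_of_entries d g h (- 2 * m) (2 * n)) = odd_comb d g + even_comb h m n" for d g h m n
    by (simp add: \<phi>_def Let_def Rep_osp12_of_entries)
  have image: "\<phi> ` osp12_part p = L p" for p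
  proof
    show "\<phi> ` osp12_part p \<subseteq> L p"
    proof
      fix x assume "x \<in> \<phi> ` osp12_part p"
      then obtain M where "x = \<phi> M" "M \<in> osp12_part p" by blast
      then show "x \<in> L p"
        using odd_comb even_comb
        by (cases p) (simp_all add: \<phi>_def Let_def osp12_part_iff coord_parity_def forall_3 comb_0)
    qed
    show "L p \<subseteq> \<phi> ` osp12_part p"
    proof
      fix x assume x: "x \<in> L p"
      show "x \<in> \<phi> ` osp12_part p"
      proof (cases p)
        case True
        then have "x \<in> L True"
          using x by simp
        then obtain d g where "x = odd_comb d g"
          using odd unfolding odd_comb_def by blast
        then have "x = \<phi> (osp12_of_entries d g 0 (- 2 * 0) (2 * 0))"
          unfolding surj by (simp add: comb_0)
        moreover have "osp12_of_entries d g 0 (- 2 * 0) (2 * 0) \<in> osp12_part p"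
          using True by (simp add: osp12_part_iff Rep_osp12_of_entries coord_parity_def forall_3)
        ultimately show ?thesis by blast
      next
        case False
        then have "x \<in> L False"
          using x by simp
        then obtain h m n where "x = even_comb h m n"
          using even unfolding even_comb_def E_def F_def H_def by blast
        then have "x = \<phi> (osp12_of_entries 0 0 h (- 2 * m) (2 * n))"
          unfolding surj by (simp add: comb_0)
        moreover have "osp12_of_entries 0 0 h (- 2 * m) (2 * n) \<in> osp12_part p"
          using False by (simp add: osp12_part_iff Rep_osp12_of_entries coord_parity_def forall_3)
        ultimately show ?thesis by blast
      qed
    qed
  qed
  have kernel: "M = 0" if "\<phi> M = 0" for M
  proof -
    let ?A = "Rep_osp12 M"
    let ?o = "odd_comb (?A$2$1) (?A$3$1)" and ?e = "even_comb (?A$2$2) (- (?A$2$3) / 2) (?A$3$2 / 2)"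
    have sum: "?o + ?e = 0"
      using that by (simp add: \<phi>_def Let_def)
    then have "?e = - ?o"
      by (simp add: add_eq_0_iff)
    \<comment> \<open>A vanishing sum makes the even summand odd as well, so both summands vanish
      separately.\<close>
    then have "?e \<in> L False \<inter> L True"
      using subspace_neg[OF subspace_L odd_comb] even_comb by (metis IntI)
    then have "?e = 0"
      using L_inter by auto
    moreover from this have "?o = 0"
      using sum by simp
    ultimately have "?A$2$1 = 0" "?A$3$1 = 0" "?A$2$2 = 0" "?A$2$3 = 0" "?A$3$2 = 0"
      using indep_odd[of "?A$2$1" "?A$3$1"] indep_even[of "?A$2$2" "- (?A$2$3) / 2" "?A$3$2 / 2"]
      by (simp_all add: odd_comb_def even_comb_def E_def F_def H_def)
    then show ?thesis
      by (simp add: Rep_osp12_inject[symmetric] vec_eq_iff forall_3 osp12_entries_eq zero_osp12.rep_eq)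
  qed
  have "inj \<phi>"
  proof (rule injI)
    fix M N assume "\<phi> M = \<phi> N"
    moreover have "\<phi> (M - N) + \<phi> N = \<phi> M"
      by (simp flip: add)
    ultimately show "M = N"
      using kernel[of "M - N"] by simp
  qed
  moreover have "surj \<phi>"
  proof -
    have "x \<in> range \<phi>" for x
    proof -
      obtain x0 x1 where "x0 \<in> L False" "x1 \<in> L True" "x = x0 + x1"
        using L_sum[of x] by blast
      moreover from this obtain M0 M1 where "x0 = \<phi> M0" "x1 = \<phi> M1"
        using image[of False] image[of True] by blast
      ultimately have "x = \<phi> (M0 + M1)"
        by (simp add: add)
      then show ?thesis by blast
    qed
    then show ?thesis by blast
  qed
  moreover have "Vector_Spaces.linear osp12_scale smul \<phi>"
    using lie_superalgebra.axioms(1)[OF lie_superalgebra_osp12] vector_space_axioms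
    by (simp add: Vector_Spaces.linear_iff add scale)
  ultimately have "superalgebra_iso osp12_scale osp12_part osp12_bracket smul L br \<phi>"
    by (simp add: superalgebra_iso_def bij_def image bracket)
  then show ?thesis
    unfolding isomorphic_def using superalgebra_iso_inverse by blast
qed

end

section \<open>The nondegenerate \<open>(3|2)\<close> case, and central vectors from a non-perfect
  even part\<close>

context finite_quadratic_lie_superalgebra
begin

text \<open>For nonzero \<open>\<alpha>\<close> the vectors \<open>E\<close> and
  \<open>smul (1 / \<alpha>) F\<close> are a hyperbolic pair, and \<open>H\<close>, orthogonal to
  both, spans the remaining line. So the odd brackets span the even part.\<close>

lemma osp12_of_odd_plane:
  assumes dim: "dim (L False) = 3"
    and e: "e \<in> L True" and f: "f \<in> L True" and ef: "B e f = 1"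
    and plane: "\<And>y. y \<in> L True \<Longrightarrow> y = smul (B y f) e - smul (B y e) f"
    and rel: "br (br e e) e = 0" "br (br e e) f = smul \<alpha> e"
    "br (br e f) e = smul (- \<alpha> / 2) e" "br (br e f) f = smul (\<alpha> / 2) f"
    "br (br f f) e = smul (- \<alpha>) f" "br (br f f) f = 0"
    and \<alpha>: "\<alpha> \<noteq> 0"
  shows "\<not> solvable smul br (L False)"
    and "isomorphic smul L br osp12_scale osp12_part osp12_bracket"
proof -
  define E F H where "E = br e e" and "F = br f f" and "H = br e f"
  have ev: "E \<in> L False" "F \<in> L False" "H \<in> L False"
    using e f by (auto simp: E_def F_def H_def br_odd)
  have sym: "B y x = B x y" if "x \<in> L False" "y \<in> L False" for x y
    using B_even_sym that by blast
  have gram: "B E E = 0" "B E F = \<alpha>" "B E H = 0" "B F F = 0" "B H F = 0" "B H H = - \<alpha> / 2"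
    "B F E = \<alpha>" "B H E = 0" "B F H = 0"
    using odd_plane_gram[OF e f ef rel] sym[OF ev(1,2)] sym[OF ev(1,3)] sym[OF ev(3,2)]
    by (simp_all add: E_def F_def H_def)
  have F': "smul (1 / \<alpha>) F \<in> L False" "B (smul (1 / \<alpha>) F) (smul (1 / \<alpha>) F) = 0" "B E (smul (1 / \<alpha>) F) = 1"
    using ev(2) \<alpha> by (simp_all add: subspace_scale[OF subspace_L] B_simps gram)
  obtain t where t: "t \<in> L False" "B t t = 1"
    and span: "\<And>x. x \<in> L False \<Longrightarrow> x = smul (B x (smul (1 / \<alpha>) F)) E + smul (B x E) (smul (1 / \<alpha>) F) + smul (B x t) t"
    using witt_three[OF nondegenerate_L sym dim ev(1) gram(1) F'] by blast
  have Ht: "H = smul (B H t) t"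
    using span[OF ev(3)] by (simp add: B_simps gram)
  then have "B H t \<noteq> 0"
    using gram(6) \<alpha> B_zero_left[of H] by force
  then have "t = smul (1 / B H t) H"
    by (subst Ht) simp
  then have even_span: "\<exists>a b c. x = smul a H + smul b E + smul c F" if x: "x \<in> L False" for x
  proof -
    have "x = smul (B x t * (1 / B H t)) H + smul (B x (smul (1 / \<alpha>) F)) E + smul (B x E * (1 / \<alpha>)) F"
      by (subst span[OF x], subst (2) \<open>t = smul (1 / B H t) H\<close>) (simp add: ac_simps)
    then show ?thesis by blast
  qed
  note brs = odd_plane_even_brackets[OF e f rel, folded E_def F_def H_def]
  show "\<not> solvable smul br (L False)"
  proof (rule perfect_not_solvable[OF _ ev(1)])
    let ?D = "span {br x y |x y. x \<in> L False \<and> y \<in> L False}"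
    have D: "br x y \<in> ?D" if "x \<in> L False" "y \<in> L False" for x y
      using that by (blast intro: span_base)
    \<comment> \<open>Each basis vector is a multiple of a bracket of even vectors, so the even part
      is perfect.\<close>
    have "H = smul (1 / (2 * \<alpha>)) (br E F)" "E = smul (- 1 / \<alpha>) (br H E)" "F = smul (1 / \<alpha>) (br H F)"
      using \<alpha> by (simp_all add: brs)
    then have HEF: "H \<in> ?D" "E \<in> ?D" "F \<in> ?D"
      using span_scale[OF D[OF ev(1,2)], of "1 / (2 * \<alpha>)"] span_scale[OF D[OF ev(3,1)], of "- 1 / \<alpha>"]
        span_scale[OF D[OF ev(3,2)], of "1 / \<alpha>"] by argo+
    show "L False \<subseteq> ?D"
    proof
      fix x assume "x \<in> L False"
      then obtain a b c where "x = smul a H + smul b E + smul c F"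
        using even_span by blast
      then show "x \<in> ?D"
        by (simp add: HEF span_add span_scale)
    qed
    show "E \<noteq> 0"
      using gram(2) \<alpha> B_zero_left[of F] by force
  qed
  \<comment> \<open>Scaling \<open>e\<close> and \<open>f\<close> by \<open>s\<close> scales their
    brackets by \<open>s * s\<close>, so \<open>\<alpha>\<close> becomes
    \<open>s * s * \<alpha>\<close>; this choice of \<open>s\<close> gives the normalised value
    -2.\<close>
  have "csqrt (- 2 / \<alpha>) * csqrt (- 2 / \<alpha>) * \<alpha> = -2"
    using \<alpha> by (simp flip: power2_eq_square)
  then obtain s where s: "s * s * \<alpha> = -2" ..
  then have s0: "s \<noteq> 0" by auto
  define e' f' where "e' = smul s e" and "f' = smul s f"
  have br': "br e' e' = smul (s * s) E" "br e' f' = smul (s * s) H" "br f' f' = smul (s * s) F"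
    by (simp_all add: e'_def f'_def E_def F_def H_def br_simps)
  have s': "s * (s * (s * \<alpha>)) = - (2 * s)"
  proof -
    have "s * (s * (s * \<alpha>)) = s * (s * s * \<alpha>)" by (simp add: ac_simps)
    then show ?thesis by (simp add: s)
  qed
  show "isomorphic smul L br osp12_scale osp12_part osp12_bracket"
  proof (rule isomorphic_osp12[of e' f'])
    show "e' \<in> L True" "f' \<in> L True"
      using e f by (simp_all add: e'_def f'_def subspace_scale[OF subspace_L])
    show "br (br e' e') e' = 0" "br (br e' e') f' = smul (-2) e'"
      "br (br e' f') e' = e'" "br (br e' f') f' = - f'" "br (br f' f') e' = smul 2 f'" "br (br f' f') f' = 0"
      unfolding br' using s' by (simp_all add: e'_def f'_def br_simps rel E_def F_def H_def ac_simps)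
    show "\<exists>a b. y = smul a e' + smul b f'" if "y \<in> L True" for y
    proof -
      have "y = smul (B y f / s) e' + smul (- B y e / s) f'"
        using plane[OF that] s0 by (simp add: e'_def f'_def)
      then show ?thesis by blast
    qed
    show "\<exists>a b c. x = smul a (br e' f') + smul b (br e' e') + smul c (br f' f')" if x: "x \<in> L False" for x
    proof -
      obtain a b c where "x = smul a H + smul b E + smul c F"
        using even_span[OF x] by blast
      then have "x = smul (a / (s * s)) (br e' f') + smul (b / (s * s)) (br e' e') + smul (c / (s * s)) (br f' f')"
        using s0 by (simp add: br')
      then show ?thesis by blast
    qed
    show "a = 0 \<and> b = 0" if ab: "smul a e' + smul b f' = 0" for a b
    proof -
      have "B e (smul a e' + smul b f') = 0" "B f (smul a e' + smul b f') = 0"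
        by (simp_all only: ab B_zero_right)
      then show ?thesis
        using s0 by (simp add: e'_def f'_def B_simps ef B_odd_self e f B_odd_skew[OF e f])
    qed
    show "a = 0 \<and> b = 0 \<and> c = 0" if abc: "smul a (br e' f') + smul b (br e' e') + smul c (br f' f') = 0" for a b c
    proof -
      have "B x (smul a (br e' f') + smul b (br e' e') + smul c (br f' f')) = 0" for x
        by (simp only: abc B_zero_right)
      from this[of H] this[of E] this[of F] show ?thesis
        using s0 \<alpha> by (simp add: br' B_simps gram)
    qed
  qed
qed

text \<open>A nonzero functional on the even part that vanishes on brackets is represented by some
  \<open>z\<close>, and \<open>B z (br x y) = 0\<close> means that \<open>br z x\<close> is
  orthogonal to the even part.\<close>

lemma exists_central_even:
  assumes nonperfect: "span {br x y |x y. x \<in> L False \<and> y \<in> L False} \<noteq> L False"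
  obtains z where "z \<in> L False" "z \<noteq> 0" "\<And>x. x \<in> L False \<Longrightarrow> br z x = 0"
proof -
  let ?D = "span {br x y |x y. x \<in> L False \<and> y \<in> L False}"
  have "?D \<subseteq> L False"
    by (rule span_minimal) (auto simp: subspace_L br_even)
  then obtain v where v: "v \<in> L False" "v \<notin> ?D"
    using nonperfect by blast
  obtain b where b: "b \<subseteq> ?D" "independent b" "?D \<subseteq> span b"
    by (rule basis_exists[of ?D])
  have sb: "span b = ?D"
    by (rule span_subspace[OF b(1,3) subspace_span])
  have vb: "v \<notin> b" "independent (insert v b)"
    using b(1) v(2) by blast (rule independent_insertI; simp only: sb v(2) b(2) not_False_eq_True)
  interpret pair: vector_space_pair smul "(*) :: complex \<Rightarrow> complex \<Rightarrow> complex"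
    by (intro vector_space_pair.intro vector_space_axioms vector_space_mult_complex)
  \<comment> \<open>The functional is prescribed on a basis of the derived algebra enlarged by a
    vector \<open>v\<close> outside it.\<close>
  obtain g where g: "Vector_Spaces.linear smul (*) g" "\<forall>x\<in>insert v b. g x = (if x = v then 1 else 0)"
    using pair.linear_independent_extend[OF vb(2), of "\<lambda>x. if x = v then 1 else 0"] by auto
  have D: "g x = 0" if "x \<in> ?D" for x
  proof (rule pair.linear_eq_0_on_span[OF g(1)])
    show "x \<in> span b"
      using that sb by simp
    show "g y = 0" if "y \<in> b" for y
      using g(2) vb(1) that by auto
  qed
  have sym: "B y x = B x y" if "x \<in> L False" "y \<in> L False" for x y
    using B_even_sym that by blast
  obtain z where z: "z \<in> L False" "\<forall>x\<in>L False. g x = B z x"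
    using riesz[OF nondegenerate_L sym g(1)] by blast
  show thesis
  proof (rule that[OF z(1)])
    show "z \<noteq> 0"
      using g(2) z(2) v(1) B_zero_left[of v] by force
    fix x assume x: "x \<in> L False"
    show "br z x = 0"
    proof (rule nondegenerateD[OF nondegenerate_L br_even[OF z(1) x]])
      fix y assume y: "y \<in> L False"
      have "br x y \<in> ?D"
        using x y by (blast intro: span_base)
      from D[OF this] have "B z (br x y) = 0"
        using z(2) br_even[OF x y] by simp
      then show "B (br z x) y = 0"
        by (simp add: B_invariant)
    qed
  qed
qed

end

section \<open>Purely even algebras\<close>

locale purely_even_quadratic_lie_algebra = finite_quadratic_lie_superalgebra +
  assumes odd_zero: "L True = {0}"
begin

lemma L_even: "L False = UNIV"
  using L_sum odd_zero by force

lemma even [simp]: "x \<in> L False"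
  by (simp add: L_even)

lemma sym: "B y x = B x y"
  by (rule B_even_sym[of _ _ False]) simp_all

lemma antisym: "br y x = - br x y" for x y
  by (rule br_even_swap[of _ _ False]) simp_all

lemma br_self: "br x x = 0"
  by (rule br_even_self) simp

lemma B_br_cyclic: "B (br y w) x = B (br x y) w" for x y w
  using sym[of x "br y w"] by (simp add: B_invariant[of x y w])

text \<open>The three-form \<open>B (br x y) w\<close> is alternating: cyclic by invariance and
  symmetry, odd under a swap by antisymmetry. Instances of these rules bring its values on basis
  vectors to one fixed order.\<close>

lemma B_br_permute: "B (br y x) w = - B (br x y) w" "B (br x w) y = - B (br x y) w"
    "B (br w y) x = - B (br x y) w" "B (br y w) x = B (br x y) w" "B (br w x) y = B (br x y) w" for x y w
proof -
  have swap: "B (br y x) w = - B (br x y) w" for x y w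
    using antisym[where x=x and y=y] by (simp add: B_simps)
  show cyclic: "B (br y w) x = B (br x y) w" "B (br w x) y = B (br x y) w"
    using B_br_cyclic[where x=x and y=y and w=w] B_br_cyclic[where x=y and y=w and w=x] by simp_all
  show "B (br y x) w = - B (br x y) w" "B (br x w) y = - B (br x y) w" "B (br w y) x = - B (br x y) w"
    using swap[where x=x and y=y and w=w] swap[where x=w and y=x and w=y] swap[where x=y and y=w and w=x] cyclic
    by simp_all
qed

lemma B_br_repeated: "B (br x x) y = 0" "B (br x y) x = 0" "B (br y x) x = 0" for x y
  using B_br_cyclic[where x=x and y=x and w=y] B_br_cyclic[where x=y and y=x and w=x] by (simp_all add: br_self B_simps)

lemma nondegenerate_UNIV: "nondegenerate UNIV"
  using nondegenerate_L[of False] by (simp add: L_even)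

lemma central_swap: "(\<And>x. br z x = 0) \<Longrightarrow> br x z = 0"
  using antisym[where x=z and y=x] by simp

text \<open>A three-form in four variables has a kernel vector: contract it with the volume form.\<close>

lemma contracted_vector_central:
  assumes z: "\<And>x. br z x = 0"
    and span: "\<And>x. \<exists>k k1 k2 k3 k4. x = smul k z + (smul k1 v + (smul k2 a + (smul k3 b + smul k4 c)))"
  shows "br (smul (B (br a b) c) v - smul (B (br v b) c) a + smul (B (br v a) c) b - smul (B (br v a) b) c) x = 0"
    (is "br ?p x = 0")
proof -
  note perm = B_br_permute[where x=v and y=a and w=b] B_br_permute[where x=v and y=a and w=c]
    B_br_permute[where x=v and y=b and w=c] B_br_permute[where x=a and y=b and w=c]
  have "B (br ?p u) w = 0" if u: "u = v \<or> u = a \<or> u = b \<or> u = c" and w: "w = v \<or> w = a \<or> w = b \<or> w = c" for u w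
    using u w by (elim disjE) (simp_all add: br_simps B_simps B_br_repeated perm)
  \<comment> \<open>Terms with the central \<open>z\<close> vanish, so only the four remaining
    spanning vectors matter: the form lives on the quotient by \<open>z\<close>.\<close>
  moreover have "B (br ?p z) w = 0" "B (br ?p u) z = 0" for u w
    using B_br_cyclic[where x=z and y="?p" and w=u] by (simp_all add: z central_swap[OF z] B_simps)
  ultimately have "B (br ?p x) y = 0" for y
    using span[of x] span[of y] by (auto simp only: br_add_right br_scale_right B_add_left B_scale_left B_add_right
        B_scale_right simp_thms mult_zero_right add_0)
  then show ?thesis
    by (rule B_nondegenerate)
qed

text \<open>The coordinate map from the model preserves the form, so nondegeneracy of
  \<open>g5_form\<close> makes it injective; \<open>span\<close> makes it surjective.\<close>

lemma i_isomorphic_g5: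
  assumes br: "br X1 X2 = T" "br X1 T = - Z2" "br X2 T = Z1"
    and central: "\<And>x. br Z1 x = 0" "\<And>x. br Z2 x = 0"
    and gram: "B X1 X1 = 0" "B X1 X2 = 0" "B X1 T = 0" "B X1 Z1 = 1" "B X1 Z2 = 0"
      "B X2 X2 = 0" "B X2 T = 0" "B X2 Z1 = 0" "B X2 Z2 = 1" "B T T = 1" "B T Z1 = 0" "B T Z2 = 0"
      "B Z1 Z1 = 0" "B Z1 Z2 = 0" "B Z2 Z2 = 0"
    and span: "\<And>x. x = smul (B x Z1) X1 + smul (B x Z2) X2 + smul (B x T) T + smul (B x X1) Z1 + smul (B x X2) Z2"
  shows "i_isomorphic smul L br B (*s) g5_part g5_bracket g5_form"
proof -
  have br': "br X1 X1 = 0" "br X2 X2 = 0" "br T T = 0" "br X2 X1 = - T" "br T X1 = Z2" "br T X2 = - Z1"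
    using br br_self antisym[where x=X1 and y=X2] antisym[where x=X1 and y=T] antisym[where x=X2 and y=T] by simp_all
  have gram': "B X2 X1 = 0" "B T X1 = 0" "B Z1 X1 = 1" "B Z2 X1 = 0" "B T X2 = 0" "B Z1 X2 = 0" "B Z2 X2 = 1"
      "B Z1 T = 0" "B Z2 T = 0" "B Z2 Z1 = 0"
    by (simp_all only: gram sym[of X2 X1] sym[of T X1] sym[of Z1 X1] sym[of Z2 X1] sym[of T X2] sym[of Z1 X2]
        sym[of Z2 X2] sym[of Z1 T] sym[of Z2 T] sym[of Z2 Z1])
  define \<phi> where "\<phi> w = smul (w$1) X1 + smul (w$2) X2 + smul (w$3) T + smul (w$4) Z1 + smul (w$5) Z2"
    for w :: "complex ^ 5"
  have form: "B (\<phi> u) (\<phi> w) = g5_form u w" for u w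
    by (simp add: \<phi>_def g5_form_def B_simps gram gram' algebra_simps)
  have bracket: "\<phi> (g5_bracket u w) = br (\<phi> u) (\<phi> w)" for u w
    by (simp add: \<phi>_def g5_bracket_nth br_simps br br' central central_swap[OF central(1)] central_swap[OF central(2)]
        algebra_simps)
  have linear: "Vector_Spaces.linear (*s) smul \<phi>"
    using vec.vector_space_axioms vector_space_axioms by (simp add: Vector_Spaces.linear_iff \<phi>_def algebra_simps)
  have nondeg: "u = 0" if "\<And>w. g5_form u w = 0" for u
    using quadratic_lie_superalgebra.B_nondegenerate[OF quadratic_g5] that by blast
  have "inj \<phi>"
  proof (rule injI)
    fix u w assume eq: "\<phi> u = \<phi> w"
    have "g5_form (u - w) y = g5_form u y - g5_form w y" for y
      by (simp add: g5_form_def algebra_simps)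
    then have "g5_form (u - w) y = 0" for y
      by (simp add: eq flip: form)
    then show "u = w"
      using nondeg[of "u - w"] by simp
  qed
  moreover have "x \<in> range \<phi>" for x
  proof
    show "x = \<phi> (\<chi> i. if i = 1 then B x Z1 else if i = 2 then B x Z2 else if i = 3 then B x T
        else if i = 4 then B x X1 else B x X2)"
      using span[of x] by (simp add: \<phi>_def)
  qed simp
  ultimately have bij: "bij \<phi>"
    by (auto simp: bij_def)
  moreover have "\<phi> 0 = 0"
    by (simp add: \<phi>_def)
  then have "\<phi> ` g5_part p = L p" for p
    using bij_is_surj[OF bij] by (cases p) (simp_all add: g5_part_def odd_zero L_even)
  ultimately have "superalgebra_iso (*s) g5_part g5_bracket smul L br \<phi>"
    by (simp add: superalgebra_iso_def linear bracket)
  then have "superalgebra_iso smul L br (*s) g5_part g5_bracket (inv \<phi>)"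
    by (rule superalgebra_iso_inverse)
  moreover have "g5_form (inv \<phi> x) (inv \<phi> y) = B x y" for x y
    by (simp add: surj_f_inv_f[OF bij_is_surj[OF bij]] flip: form)
  ultimately show ?thesis
    unfolding i_isomorphic_def by blast
qed

lemma solvable_dim_five:
  assumes ind: "indecomposable smul L br B" and dim: "dim (UNIV :: 'a set) = 5" and solv: "solvable smul br (L False)"
  shows "i_isomorphic smul L br B (*s) g5_part g5_bracket g5_form"
proof -
  have isotropic: "B z z = 0" if "\<And>x. br z x = 0" for z
    using even_part_central_isotropic[OF ind _ _ that] dim by simp
  have "L False \<noteq> {0}"
    unfolding L_even using dim_zero_eq[OF subspace_UNIV] dim by linarith
  then obtain x :: 'a where "x \<noteq> 0"
    using L_even by auto
  have "span {br x y |x y. x \<in> L False \<and> y \<in> L False} \<noteq> L False"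
    using perfect_not_solvable[of "L False" x] \<open>x \<noteq> 0\<close> solv by auto
  then obtain z where z: "z \<noteq> 0" and z_central: "\<And>x. br z x = 0"
    using exists_central_even by (metis even)
  obtain v where v: "B z v = 1" "B v v = 0"
    using exists_hyperbolic[OF nondegenerate_UNIV sym UNIV_I z isotropic[OF z_central]] by blast
  define U where "U = {x. B x z = 0 \<and> B x v = 0}"
  have sym1: "B y x = 1 * B x y" for x y
    using sym by simp
  have U: "nondegenerate U" "dim U = 3"
    using split_hyperbolic[OF nondegenerate_UNIV sym1 _ UNIV_I isotropic[OF z_central] UNIV_I v(2,1)] dim
    by (simp_all add: U_def)
  note sub = nondegenerate_subspace[OF U(1)]
  have dec: "x - smul (B x v) z - smul (B x z) v \<in> U" for x
    using v isotropic[OF z_central] sym[of v z] by (simp add: U_def B_simps)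
  obtain p where p: "p \<in> U" "p \<noteq> 0" "\<And>x. br p x = 0"
  proof -
    have "U \<noteq> {0}"
      by (rule nonzero_of_dim) (use U(2) in linarith)
    then obtain a where a: "a \<in> U" "B a a = 1"
      using exists_unit[OF U(1) _ sym] by blast
    let ?Ua = "{x \<in> U. B x a = 0}"
    have Ua: "nondegenerate ?Ua" "dim ?Ua = 2"
      using split_unit[OF U(1) sym a] U(2) by simp_all
    have "?Ua \<noteq> {0}"
      by (rule nonzero_of_dim) (use Ua(2) in linarith)
    then obtain b where b: "b \<in> ?Ua" "B b b = 1"
      using exists_unit[OF Ua(1) _ sym] by blast
    let ?Ub = "{x \<in> ?Ua. B x b = 0}"
    have Ub: "nondegenerate ?Ub" "dim ?Ub = 1"
      using split_unit[OF Ua(1) sym b] Ua(2) by simp_all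
    have "?Ub \<noteq> {0}"
      by (rule nonzero_of_dim) (use Ub(2) in linarith)
    then obtain c where c: "c \<in> ?Ub" "B c c = 1"
      using exists_unit[OF Ub(1) _ sym] by blast
    have "nondegenerate {x \<in> ?Ub. B x c = 0}" "dim {x \<in> ?Ub. B x c = 0} = 0"
      using split_unit[OF Ub(1) sym c] Ub(2) by simp_all
    then have orth: "{x \<in> ?Ub. B x c = 0} = {0}"
      using dim_zero_eq[OF nondegenerate_subspace] by blast
    have gram: "B a z = 0" "B a v = 0" "B b z = 0" "B b v = 0" "B c z = 0" "B c v = 0" "B b a = 0" "B c a = 0" "B c b = 0"
      using a b c by (auto simp: U_def)
    have gram': "B a b = 0" "B a c = 0" "B b c = 0" "B v a = 0" "B v b = 0" "B v c = 0" "B v z = 1"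
      using gram v(1) sym[of a b] sym[of a c] sym[of b c] sym[of v a] sym[of v b] sym[of v c] sym[of v z] by simp_all
    have spanU: "x = smul (B x a) a + smul (B x b) b + smul (B x c) c" if x: "x \<in> U" for x
    proof -
      have "x - (smul (B x a) a + smul (B x b) b + smul (B x c) c) \<in> U"
        using a b c x by (simp add: subspace_diff[OF sub] subspace_add[OF sub] subspace_scale[OF sub])
      then have "x - (smul (B x a) a + smul (B x b) b + smul (B x c) c) \<in> {x \<in> ?Ub. B x c = 0}"
        using a b c gram gram' by (simp add: B_simps)
      then show ?thesis
        unfolding orth by simp
    qed
    have span: "\<exists>k k1 k2 k3 k4. x = smul k z + (smul k1 v + (smul k2 a + (smul k3 b + smul k4 c)))" for x
    proof -
      obtain y where y: "y \<in> U" "y = x - smul (B x v) z - smul (B x z) v"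
        using dec by blast
      have "x = smul (B x v) z + (smul (B x z) v + y)"
        using y(2) by simp
      also have "y = smul (B y a) a + (smul (B y b) b + smul (B y c) c)"
        using spanU[OF y(1)] by (simp only: add.assoc)
      finally show ?thesis by blast
    qed
    define p where "p = smul (B (br a b) c) v - smul (B (br v b) c) a + smul (B (br v a) c) b - smul (B (br v a) b) c"
    have p_central: "br p x = 0" for x
      unfolding p_def by (rule contracted_vector_central[OF z_central span])
    have Bp: "B p z = B (br a b) c" "B p v = 0" "B p a = - B (br v b) c" "B p b = B (br v a) c" "B p c = - B (br v a) b"
      using gram gram' a(2) b(2) c(2) v(2) by (simp_all add: p_def B_simps)
    \<comment> \<open>Sums of central vectors are central, hence isotropic; polarisation gives
      \<open>B p z = 0\<close>. With \<open>B p v = 0\<close> this puts \<open>p\<close> into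
      \<open>U\<close>.\<close>
    have "B (p + z) (p + z) = 0" "B p p = 0" "B z z = 0"
      by (rule isotropic; simp add: br_simps p_central z_central)+
    then have pz: "B p z = 0"
      using sym[of z p] by (simp add: B_simps)
    \<comment> \<open>The coefficients of \<open>p\<close> are the four values of the three-form on
      \<open>v\<close>, \<open>a\<close>, \<open>b\<close>, \<open>c\<close>. If all were zero, the
      unit vector \<open>a\<close> would be central.\<close>
    have "p \<noteq> 0"
    proof
      assume "p = 0"
      then have zero: "B (br a b) c = 0" "B (br v b) c = 0" "B (br v a) c = 0" "B (br v a) b = 0"
        using Bp by (simp_all add: B_simps)
      note perm = B_br_permute[where x=v and y=a and w=b] B_br_permute[where x=v and y=a and w=c]
        B_br_permute[where x=v and y=b and w=c] B_br_permute[where x=a and y=b and w=c]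
      have "B (br a x) y = 0" for x y
      proof -
        have "B (br a u) w = 0" if "u = v \<or> u = a \<or> u = b \<or> u = c" "w = v \<or> w = a \<or> w = b \<or> w = c" for u w
          using that by (elim disjE) (simp_all add: B_br_repeated perm zero)
        moreover have "B (br a z) w = 0" "B (br a u) z = 0" for u w
          using B_br_cyclic[where x=z and y=a and w=u] by (simp_all add: z_central central_swap[OF z_central] B_simps)
        ultimately show ?thesis
          using span[of x] span[of y] by (auto simp only: br_add_right br_scale_right B_add_left B_scale_left B_add_right
              B_scale_right simp_thms mult_zero_right add_0)
      qed
      then have "br a x = 0" for x
        using B_nondegenerate by blast
      then show False
        using isotropic[of a] a(2) by simp
    qed
    with pz Bp(2) p_central show thesis
      using that[of p] by (simp add: U_def)
  qed
  obtain q where q: "q \<in> U" "B p q = 1" "B q q = 0"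
    using exists_hyperbolic[OF U(1) sym p(1,2) isotropic[OF p(3)]] by blast
  obtain t where t: "t \<in> U" "B t p = 0" "B t q = 0" "B t t = 1"
    and spanU: "\<And>x. x \<in> U \<Longrightarrow> x = smul (B x q) p + smul (B x p) q + smul (B x t) t"
    using witt_three[OF U(1) sym U(2) p(1) isotropic[OF p(3)] q(1,3,2)] by blast
  have gram: "B p z = 0" "B p v = 0" "B q z = 0" "B q v = 0" "B t z = 0" "B t v = 0" "B z z = 0" "B p p = 0"
    using p(1) q(1) t(1) isotropic[OF z_central] isotropic[OF p(3)] by (auto simp: U_def)
  have gram': "B z p = 0" "B v p = 0" "B z q = 0" "B v q = 0" "B z t = 0" "B v t = 0" "B v z = 1" "B q p = 1"
      "B p t = 0" "B q t = 0"
    using gram v(1) q(2) t(2,3) sym[of z p] sym[of v p] sym[of z q] sym[of v q] sym[of z t] sym[of v t] sym[of v z]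
      sym[of q p] sym[of p t] sym[of q t] by simp_all
  have span: "x = smul (B x v) z + smul (B x z) v + smul (B x q) p + smul (B x p) q + smul (B x t) t" for x
  proof -
    obtain y where y: "y \<in> U" "y = x - smul (B x v) z - smul (B x z) v"
      using dec by blast
    have "B y q = B x q" "B y p = B x p" "B y t = B x t"
      using gram' by (simp_all add: y(2) B_simps)
    then have "y = smul (B x q) p + smul (B x p) q + smul (B x t) t"
      using spanU[OF y(1)] by simp
    then show ?thesis
      using y(2) by (simp add: algebra_simps)
  qed
  \<comment> \<open>In the basis \<open>z\<close>, \<open>v\<close>, \<open>p\<close>,
    \<open>q\<close>, \<open>t\<close> the three-form vanishes as soon as \<open>z\<close> or
    \<open>p\<close> occurs, so this is its only independent value.\<close>
  define c where "c = B (br v q) t"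
  note perm = B_br_permute[where x=v and y=q and w=t, folded c_def]
  have B_central: "B (br x y) z = 0" "B (br x y) p = 0" for x y
    using B_br_cyclic[where x=z and y=x and w=y] B_br_cyclic[where x=p and y=x and w=y] by (simp_all add: z_central p(3) B_simps)
  have vq: "br v q = smul c t" and vt: "br v t = smul (- c) p" and qt: "br q t = smul c z"
    using span[of "br v q"] span[of "br v t"] span[of "br q t"] by (simp_all add: B_central B_br_repeated perm c_def[symmetric])
  \<comment> \<open>Otherwise the unit vector \<open>t\<close> would be central.\<close>
  have c: "c \<noteq> 0"
  proof
    assume "c = 0"
    have "br t x = 0" for x
    proof -
      have "br t v = 0" "br t q = 0" "br t t = 0" "br t z = 0" "br t p = 0"
        using \<open>c = 0\<close> vt qt antisym[where x=v and y=t] antisym[where x=q and y=t] br_self central_swap[OF z_central] central_swap[OF p(3)]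
        by simp_all
      then have "br t (smul (B x v) z + smul (B x z) v + smul (B x q) p + smul (B x p) q + smul (B x t) t) = 0"
        by (simp add: br_simps)
      then show ?thesis
        using span[of x] by simp
    qed
    then show False
      using isotropic[of t] t(4) by simp
  qed
  show ?thesis
  \<comment> \<open>The last two instances are \<open>Z2\<close> and \<open>Z1\<close>, in this
    order of occurrence. Dividing \<open>v\<close> by \<open>c\<close> gives
    \<open>br X1 X2 = T\<close>, and multiplying \<open>z\<close> by \<open>c\<close> keeps
    \<open>B X1 Z1 = 1\<close>.\<close>
  proof (rule i_isomorphic_g5[of "smul (1 / c) v" q t p "smul c z"])
    show "x = smul (B x (smul c z)) (smul (1 / c) v) + smul (B x p) q + smul (B x t) t
        + smul (B x (smul (1 / c) v)) (smul c z) + smul (B x q) p" for x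
    proof -
      have "smul (B x v) z + smul (B x z) v + smul (B x q) p + smul (B x p) q + smul (B x t) t =
          smul (B x z) v + smul (B x p) q + smul (B x t) t + smul (B x v) z + smul (B x q) p"
        by (simp only: ac_simps)
      then show ?thesis
        using span[of x] c by (simp add: B_simps)
    qed
  qed (use c in \<open>simp_all add: br_simps B_simps vq vt qt z_central p(3) gram gram' v q t\<close>)
qed

end

section \<open>Assembly of the dimension cases\<close>

theorem mainTheorem5:
  fixes smul :: "complex \<Rightarrow> 'a::ab_group_add \<Rightarrow> 'a"
    and L :: "bool \<Rightarrow> 'a set"
    and br :: "'a \<Rightarrow> 'a \<Rightarrow> 'a"
    and B :: "'a \<Rightarrow> 'a \<Rightarrow> complex"
  assumes "quadratic_lie_superalgebra smul L br B"
    and "indecomposable smul L br B"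
    and "vector_space.dim smul (UNIV :: 'a set) = 5"
  shows "(solvable smul br (L False) \<longrightarrow>
            i_isomorphic smul L br B (*s) g5_part g5_bracket g5_form) \<and>
         (L True \<noteq> {0} \<and> \<not> solvable smul br (L False) \<longrightarrow>
            vector_space.dim smul (L False) = 3 \<and> vector_space.dim smul (L True) = 2 \<and>
            isomorphic smul L br osp12_scale osp12_part osp12_bracket)"
proof -
  interpret quadratic_lie_superalgebra smul L br B by fact
  have dim5: "dim (UNIV :: 'a set) = 5" by fact
  \<comment> \<open>\<open>dim\<close> defaults to 0 without a basis and \<open>card\<close> to 0 on
    an infinite set; the value 5 excludes both.\<close>
  have "\<exists>b. finite b \<and> independent b \<and> span b = UNIV"
  proof -
    obtain b where "independent b" "span b = span (UNIV :: 'a set)"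
      using dim5 unfolding dim_def by (metis zero_neq_numeral)
    moreover from this have "card b = 5"
      using dim5 by (metis dim_eq_card)
    ultimately show ?thesis
      by (metis card.infinite span_UNIV zero_neq_numeral)
  qed
  then interpret finite_quadratic_lie_superalgebra smul L br B
    by unfold_locales
  have sum: "dim (L False) + dim (L True) = 5"
    using dim_L dim5 by simp
  moreover have "even (dim (L True))"
    by (rule even_dim_symplectic[OF nondegenerate_L]) simp
  moreover have "dim (L False) \<noteq> 1"
    using even_line_contradiction[OF assms(2)] dim5 by auto
  moreover have "q = 0 \<or> q = 2 \<and> p = 3" if "p + q = 5" "even q" "p \<noteq> 1" for p q :: nat
    using that by presburger
  ultimately have "dim (L True) = 0 \<or> dim (L True) = 2 \<and> dim (L False) = 3"
    by blast
  then show ?thesis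
  proof (elim disjE conjE)
    assume "dim (L True) = 0"
    then have odd_zero: "L True = {0}"
      using dim_zero_eq[OF subspace_L, of True] by linarith
    then interpret purely_even_quadratic_lie_algebra smul L br B
      by unfold_locales
    \<comment> \<open>Here the second claim is vacuous, since the odd part is zero.\<close>
    show ?thesis
      using solvable_dim_five[OF assms(2) dim5] odd_zero by blast
  next
    assume dims: "dim (L True) = 2" "dim (L False) = 3"
    obtain e f where ef: "e \<in> L True" "f \<in> L True" "B e f = 1"
      and plane: "\<And>y. y \<in> L True \<Longrightarrow> y = smul (B y f) e - smul (B y e) f"
      using odd_plane_basis[OF dims(1)] by blast
    obtain \<alpha> where rel: "br (br e e) e = 0" "br (br e e) f = smul \<alpha> e"
      "br (br e f) e = smul (- \<alpha> / 2) e" "br (br e f) f = smul (\<alpha> / 2) f"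
      "br (br f f) e = smul (- \<alpha>) f" "br (br f f) f = 0"
      by (rule odd_plane_brackets[OF ef plane])
    have "\<alpha> \<noteq> 0"
      by (rule odd_plane_scalar_nonzero[OF assms(2) dims(2,1) ef plane rel])
    \<comment> \<open>The even part is not solvable in this case, so the first claim is
      vacuous.\<close>
    note osp12_of_odd_plane[OF dims(2) ef plane rel this]
    then show ?thesis
      using dims by blast
  qed
qed

end
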